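(* Let $n\ge1$, let $\mu$ be a partition with $\ell(\mu)\le n$ and $\mu'_1+\mu'_2\le n$, let $\lambda$ be a partition with $\ell(\lambda)\le n$, and let $\delta$ be a partition of length $\le n$ with all parts even. For a Littlewood–Richardson tableau $U$ of shape $\lambda/\delta$ with content $\mu^\pi$, let $\sigma_i$ be the row index of the leftmost entry $\mu'_1-i+1$ in $U$ for $1\le i\le\mu'_1$, and let $\tau_j$ be the row index of the second leftmost entry $\mu'_1-j+1$ in $U$ for $1\le j\le\mu'_2$. Let $m_1<\dots<m_{\mu'_1}$ be the sequence $m_i=\min\{n-\sigma_i+1,2i-1\}$, and let $n_1\le\dots\le n_{\mu'_2}$ be the sequence such that $n_j$ is the $j$-th smallest number in $\{j+1,\dots,n\}\setminus\{m_{j+1},\dots,m_{\mu'_1}\}$. Then $\underline c^{\lambda}_{\delta\mu}$ is equal to the number of such $U$ satisfying $$\tau_j+n_j\le n+1\qquad\text{for all }1\le j\le\mu'_2 .$$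
   Context: $'$ denotes conjugation of partitions. $\mu^\pi$ is the diagram of $\mu$ rotated by $180^\circ$. $SST(\cdot)$ is the set of semistandard tableaux of given (skew) shape with positive integer entries; $w(T)$ is the word reading columns right to left, each from top to bottom. A Littlewood–Richardson tableau of shape $\lambda/\delta$ with content $\mu^\pi$ is $U\in SST(\lambda/\delta)$ in which $i$ occurs $\mu_{\ell(\mu)-i+1}$ times for $1\le i\le\ell(\mu)$ (and no other entries occur) and whose word $w(U)=w_1\cdots w_k$ is anti-lattice: for every $a\ge1$ and $1<i\le\ell(\mu)$ the number of $i$'s in $w_a\cdots w_k$ is at least the number of $(i-1)$'s. Rows of $U$ are indexed from the top as rows of $\lambda$. The number $\underline c^\lambda_{\delta\mu}$ is defined as follows. $a\to T$ is column insertion (start with the leftmost column; $a$ replaces the smallest entry $\ge a$, which is inserted in the next column; if none exists $a$ is added at the bottom); for $w(S)=w_1\cdots w_k$, $(S\to T)=(w_k\to(\cdots\to(w_1\to T)))$; $H_\nu\in SST(\nu)$ has row $i$ filled with $i$. Put $p=\mu'_1$, $q=\mu'_2$, $r=p$ if $n-2\mu'_1\ge0$ and $r=n-\mu'_1$ if $n-2\mu'_1<0$. Then $\underline c^\lambda_{\delta\mu}$ is the number of $V\in SST(\mu^\pi)$ with $(V\to H_\delta)=H_\lambda$ such that, with $\sigma_1>\dots>\sigma_p$ the entries of the rightmost column and $\tau_1>\dots>\tau_q$ the entries of the second rightmost column of $V$, with $m_i=\min\{n-\sigma_i+1,2i-1\}$ for $1\le i\le r$, $m_i=\min\{n-\sigma_i+1,n-p+i\}$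 for $r<i\le p$, and $n_j$ the $j$-th smallest number in $\{j+1,\dots,n\}\setminus\{m_{j+1},\dots,m_p\}$, one has $\tau_j+n_j\le n+1$ for all $1\le j\le q$. *)

theory Defs
  imports Main
begin

text \<open>Partitions are weakly decreasing lists of positive integers. Cells, rows, columns and parts are
  numbered from 1; diagrams are drawn with row 1 at the top and column 1 at the left.\<close>

definition is_partition :: "nat list \<Rightarrow> bool" where
  "is_partition mu \<longleftrightarrow> sorted_wrt (\<ge>) mu \<and> 0 \<notin> set mu"

definition part :: "nat list \<Rightarrow> nat \<Rightarrow> nat" where
  "part mu i = (if 1 \<le> i \<and> i \<le> length mu then mu ! (i - 1) else 0)"

definition conj_part :: "nat list \<Rightarrow> nat \<Rightarrow> nat" where
  "conj_part mu j = card {i \<in> {1..length mu}. j \<le> part mu i}"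

definition diagram :: "nat list \<Rightarrow> (nat \<times> nat) set" where
  "diagram mu = {(i, j). 1 \<le> i \<and> i \<le> length mu \<and> 1 \<le> j \<and> j \<le> part mu i}"

definition rotated_diagram :: "nat list \<Rightarrow> (nat \<times> nat) set" where
  "rotated_diagram mu = (\<lambda>(i, j). (length mu + 1 - i, part mu 1 + 1 - j)) ` diagram mu"

text \<open>Entries of tableaux are positive, so a tableau is encoded as a function that is \<open>0\<close> exactly
  outside its shape; the shape is thus determined by the tableau.\<close>

type_synonym tableau = "nat \<times> nat \<Rightarrow> nat"

definition shape :: "tableau \<Rightarrow> (nat \<times> nat) set" where
  "shape T = {c. T c \<noteq> 0}"

definition SST :: "(nat \<times> nat) set \<Rightarrow> tableau set" where
  "SST D = {T. shape T = D \<and>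
     (\<forall>i j j'. (i, j) \<in> D \<and> (i, j') \<in> D \<and> j < j' \<longrightarrow> T (i, j) \<le> T (i, j')) \<and>
     (\<forall>i i' j. (i, j) \<in> D \<and> (i', j) \<in> D \<and> i < i' \<longrightarrow> T (i, j) < T (i', j))}"

text \<open>The nonempty columns from left to right, each read from top to bottom. A tableau of
  straight shape is determined by this list.\<close>

definition columns :: "tableau \<Rightarrow> nat list list" where
  "columns T = map (\<lambda>j. map (\<lambda>i. T (i, j)) (sorted_list_of_set {i. (i, j) \<in> shape T}))
     (sorted_list_of_set (snd ` shape T))"

definition reading_word :: "tableau \<Rightarrow> nat list" where
  "reading_word T = concat (rev (columns T))"

text \<open>Column insertion into a tableau of straight shape, given by its list of columns.\<close>

fun column_insert :: "nat \<Rightarrow> nat list list \<Rightarrow> nat list list" where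
  "column_insert a [] = [[a]]"
| "column_insert a (C # Cs) =
     (if \<exists>b\<in>set C. a \<le> b
      then let b = Min {b \<in> set C. a \<le> b}
           in map (\<lambda>x. if x = b then a else x) C # column_insert b Cs
      else (C @ [a]) # Cs)"

definition insert_tableau :: "tableau \<Rightarrow> nat list list \<Rightarrow> nat list list" where
  "insert_tableau S Cs = fold column_insert (reading_word S) Cs"

definition H_tableau :: "nat list \<Rightarrow> tableau" where
  "H_tableau nu = (\<lambda>(i, j). if (i, j) \<in> diagram nu then i else 0)"

definition jth_smallest :: "nat \<Rightarrow> nat set \<Rightarrow> nat" where
  "jth_smallest j A = sorted_list_of_set A ! (j - 1)"

definition n_seq :: "nat \<Rightarrow> nat \<Rightarrow> (nat \<Rightarrow> nat) \<Rightarrow> nat \<Rightarrow> nat" where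
  "n_seq n p m j = jth_smallest j ({j + 1..n} - m ` {j + 1..p})"

text \<open>In a tableau of shape \<^term>\<open>rotated_diagram mu\<close> all columns end in row
  \<^term>\<open>conj_part mu 1\<close>, so \<open>\<sigma>\<close> and \<open>\<tau>\<close> below read the last two columns from bottom to top.
  Truncation in \<open>n + 1 - \<sigma> i\<close> never occurs: the entries of \<open>V\<close> are at most
  \<^term>\<open>length lam\<close>, which is at most \<open>n\<close> wherever this number is used.\<close>

definition c_under :: "nat \<Rightarrow> nat list \<Rightarrow> nat list \<Rightarrow> nat list \<Rightarrow> nat" where
  "c_under n lam delta mu = card {V \<in> SST (rotated_diagram mu).
     insert_tableau V (columns (H_tableau delta)) = columns (H_tableau lam) \<and>
     (let p = conj_part mu 1;
          q = conj_part mu 2;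
          r = (if 2 * p \<le> n then p else n - p);
          \<sigma> = (\<lambda>i. V (p + 1 - i, part mu 1));
          \<tau> = (\<lambda>j. V (p + 1 - j, part mu 1 - 1));
          m = (\<lambda>i. if i \<le> r then min (n + 1 - \<sigma> i) (2 * i - 1)
                   else min (n + 1 - \<sigma> i) (n - p + i))
      in \<forall>j\<in>{1..q}. \<tau> j + n_seq n p m j \<le> n + 1)}"

definition LR_tableaux :: "nat list \<Rightarrow> nat list \<Rightarrow> nat list \<Rightarrow> tableau set" where
  "LR_tableaux lam delta mu = {U \<in> SST (diagram lam - diagram delta).
     diagram delta \<subseteq> diagram lam \<and>
     (\<forall>i\<in>{1..length mu}. card {c. U c = i} = part mu (length mu + 1 - i)) \<and>
     (\<forall>c. U c \<le> length mu) \<and>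
     (\<forall>a\<ge>1. \<forall>i. 1 < i \<and> i \<le> length mu \<longrightarrow>
        count_list (drop (a - 1) (reading_word U)) (i - 1)
          \<le> count_list (drop (a - 1) (reading_word U)) i)}"

text \<open>Row index of the \<open>k\<close>-th leftmost entry \<open>e\<close>. In a semistandard tableau equal entries lie
  in distinct columns.\<close>

definition row_of_leftmost :: "tableau \<Rightarrow> nat \<Rightarrow> nat \<Rightarrow> nat" where
  "row_of_leftmost U k e =
     (THE i. U (i, jth_smallest k {j. \<exists>i. U (i, j) = e}) = e)"

end

theory Submission
  imports Defs "HOL-Library.Multiset"
begin

text \<open>Both sides count matrices \<open>N\<close> of natural numbers. For a tableau \<open>V\<close> of rotated shape let \<open>N k a\<close> be the number
  of entries \<open>a\<close> in row \<open>k\<close>; for a Littlewood-Richardson tableau \<open>U\<close> let \<open>N k a\<close> be the number of entries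
  \<open>k\<close> in row \<open>a\<close>. The numbers of the various entries in its rows determine a semistandard tableau of given
  shape, and column strictness becomes a system of linear inequalities (\<open>bij_betw_row_count\<close>). So the bijection between
  the tableaux \<open>V\<close> and \<open>U\<close> is the transposition of matrices, once all other conditions are also expressed by \<open>N\<close>.

  Inserting a letter \<open>a\<close> into \<open>H\<^sub>\<nu>\<close> gives a highest weight tableau exactly if a box can be added to row \<open>a\<close> of
  \<open>\<nu>\<close>, and insertion never returns to the highest weight tableaux. Hence \<open>(V \<rightarrow> H\<^sub>\<delta>) = H\<^sub>\<lambda>\<close> means that \<open>\<delta>\<close> plus
  the content of any prefix of the column reading of \<open>V\<close> is a partition, and that the whole content leads to \<open>\<lambda>\<close>
  (\<open>fold_column_insert_initial_iff\<close>). Such a condition on prefixes, and likewise the anti-lattice condition on suffixes,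
  is equivalent to a condition on whole rows (\<open>column_prefix_iff_row_prefix\<close>). In terms of \<open>N\<close>, the insertion
  condition on \<open>V\<close> then is column strictness and the shape of \<open>U\<close>, while column strictness and the shape of \<open>V\<close> are
  the anti-lattice condition on \<open>U\<close> and its content (\<open>contents_transpose_iff\<close>).

  It remains to compare the inequalities for \<open>\<sigma>\<close>, \<open>\<tau>\<close>. The \<open>t\<close>-th entry from the right in row \<open>k\<close> of \<open>V\<close> is the \<open>t\<close>-th
  largest \<open>a\<close>, counted with multiplicity \<open>N k a\<close>, and so is the row of the \<open>t\<close>-th leftmost entry \<open>k\<close> of \<open>U\<close>
  (\<open>entry_from_right\<close>, \<open>row_of_leftmost_eq\<close>); this identifies the two versions of \<open>\<sigma>\<close> and \<open>\<tau>\<close>. The two definitions of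
  \<open>m\<close> agree since the entries of the last column of \<open>V\<close> are at least their row indices (\<open>V_selected_iff\<close>).\<close>

section \<open>Column insertion into highest weight tableaux\<close>

definition initial_column :: "nat \<Rightarrow> nat list" where
  "initial_column l = [1..<Suc l]"

text \<open>The list \<open>ls\<close> is read as the list of column lengths of a diagram: row \<open>a\<close> has a
  box in every column of length at least \<open>a\<close>.\<close>

definition row_length :: "nat list \<Rightarrow> nat \<Rightarrow> nat" where
  "row_length ls a = length (filter (\<lambda>l. a \<le> l) ls)"

text \<open>For strictly increasing columns this is the counting form of the condition that \<open>B\<close> may stand
  to the right of \<open>A\<close> in a tableau: \<open>B\<close> is not longer than \<open>A\<close>, and the
  \<open>i\<close>-th smallest entry of \<open>A\<close> is at most the \<open>i\<close>-th smallest entry of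
  \<open>B\<close>. Counting avoids all reference to the positions of entries.\<close>

definition dominates :: "nat set \<Rightarrow> nat set \<Rightarrow> bool" where
  "dominates A B \<longleftrightarrow> (\<forall>x. card {y \<in> B. y < x} \<le> card {y \<in> A. y < x})"

text \<open>The effect of an insertion on the set of entries of a single column.\<close>

definition bump :: "nat \<Rightarrow> nat set \<Rightarrow> nat set" where
  "bump a A = (if \<exists>b\<in>A. a \<le> b then insert a (A - {Min {b \<in> A. a \<le> b}}) else insert a A)"

fun head_entries :: "nat list list \<Rightarrow> nat set" where
  "head_entries [] = {}"
| "head_entries (C # Cs) = set C"

text \<open>An invariant of column insertion. Distinctness takes the place of monotonicity inside a column, because
  \<^const>\<open>column_insert\<close> and \<^const>\<open>dominates\<close> only depend on the set of its
  entries.\<close>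

fun tableau_columns :: "nat list list \<Rightarrow> bool" where
  "tableau_columns [] = True"
| "tableau_columns (C # Cs) = (distinct C \<and> dominates (set C) (head_entries Cs) \<and> tableau_columns Cs)"

lemma finite_head_entries [simp]: "finite (head_entries Cs)"
  by (cases Cs) auto

lemma Min_ge_props:
  assumes "finite A" "\<exists>b\<in>A. a \<le> (b::nat)"
  defines "b \<equiv> Min {b \<in> A. a \<le> b}"
  shows "b \<in> A" "a \<le> b" "\<And>y. y \<in> A \<Longrightarrow> a \<le> y \<Longrightarrow> b \<le> y"
proof -
  have "b \<in> {b \<in> A. a \<le> b}" unfolding b_def using assms by (intro Min_in) auto
  then show "b \<in> A" "a \<le> b" by auto
  show "\<And>y. y \<in> A \<Longrightarrow> a \<le> y \<Longrightarrow> b \<le> y" unfolding b_def using assms by (intro Min_le) auto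
qed

lemma head_entries_column_insert: "head_entries (column_insert a Cs) = bump a (head_entries Cs)"
proof (cases Cs)
  case Nil
  then show ?thesis by (simp add: bump_def)
next
  case (Cons C Ds)
  show ?thesis
  proof (cases "\<exists>b\<in>set C. a \<le> b")
    case True
    show ?thesis using Cons True Min_ge_props[OF finite_set True]
      by (auto simp: bump_def Let_def image_iff)
  next
    case False
    then show ?thesis using Cons by (auto simp: bump_def)
  qed
qed

text \<open>Replacing \<open>b\<close> by \<open>a \<le> b\<close> can only increase the counts of \<open>A\<close>.
  The counts of \<open>B\<close> increase at most by one, and only at thresholds \<open>x > b\<close> such that
  \<open>B\<close> has no entry from \<open>b\<close> up to \<open>x - 1\<close>. At such a threshold there was room
  for one more: \<open>B\<close> has no more entries below \<open>x\<close> than below \<open>b\<close>, whereas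
  \<open>A\<close> gains at least \<open>b\<close> itself.\<close>

lemma dominates_replace:
  assumes fin: "finite A" "finite B" and dom: "dominates A B"
    and b: "b \<in> A" "a \<le> b" and new: "a \<notin> A \<or> a = b"
  shows "dominates (insert a (A - {b})) (bump b B)"
  unfolding dominates_def
proof
  fix x
  let ?A' = "insert a (A - {b})" and ?B' = "bump b B"
  have ge: "card {y \<in> A. y < x} \<le> card {y \<in> ?A'. y < x}"
  proof (cases "b < x")
    case True
    have "{y \<in> ?A'. y < x} = insert a ({y \<in> A. y < x} - {b})" using b True by auto
    then show ?thesis using new fin True b by (auto simp: card_insert_if card_Diff_singleton)
  next
    case False
    then have "{y \<in> A. y < x} \<subseteq> {y \<in> ?A'. y < x}" using b by auto
    then show ?thesis using fin by (intro card_mono) auto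
  qed
  have domx: "card {y \<in> B. y < z} \<le> card {y \<in> A. y < z}" for z
    using dom by (simp add: dominates_def)
  have "card {y \<in> ?B'. y < x} \<le> card {y \<in> A. y < x}"
  proof (cases "b < x")
    case False
    then have "{y \<in> ?B'. y < x} \<subseteq> {y \<in> B. y < x}" by (auto simp: bump_def split: if_splits)
    then have "card {y \<in> ?B'. y < x} \<le> card {y \<in> B. y < x}" using fin by (intro card_mono) auto
    then show ?thesis using domx[of x] by simp
  next
    case True
    show ?thesis
    proof (cases "\<exists>c\<in>B. b \<le> c \<and> c < x")
      case True': True
      then have ex: "\<exists>c\<in>B. b \<le> c" by auto
      define c where "c = Min {c \<in> B. b \<le> c}"
      have c: "c \<in> B" "c < x" using Min_ge_props[OF fin(2) ex] True' unfolding c_def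
        by (auto intro: le_less_trans)
      have "{y \<in> ?B'. y < x} \<subseteq> insert b ({y \<in> B. y < x} - {c})"
        using ex by (auto simp: bump_def c_def)
      then have "card {y \<in> ?B'. y < x} \<le> card (insert b ({y \<in> B. y < x} - {c}))"
        using fin by (intro card_mono) auto
      also have "\<dots> \<le> Suc (card ({y \<in> B. y < x} - {c}))"
        by (simp add: card_insert_if fin)
      also have "\<dots> = card {y \<in> B. y < x}" using fin c by (intro card_Suc_Diff1) auto
      finally show ?thesis using domx[of x] by simp
    next
      case False
      then have "{y \<in> ?B'. y < x} \<subseteq> insert b {y \<in> B. y < b}"
        by (auto simp: bump_def split: if_splits)
      then have "card {y \<in> ?B'. y < x} \<le> card (insert b {y \<in> B. y < b})"
        using fin by (intro card_mono) auto
      also have "\<dots> = Suc (card {y \<in> B. y < b})" using fin by simp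
      also have "\<dots> \<le> Suc (card {y \<in> A. y < b})" using domx by simp
      also have "\<dots> = card (insert b {y \<in> A. y < b})" using fin by simp
      also have "\<dots> \<le> card {y \<in> A. y < x}" using fin b \<open>b < x\<close> by (intro card_mono) auto
      finally show ?thesis .
    qed
  qed
  then show "card {y \<in> ?B'. y < x} \<le> card {y \<in> ?A'. y < x}" using ge by simp
qed

lemma tableau_columns_column_insert: "tableau_columns Cs \<Longrightarrow> tableau_columns (column_insert a Cs)"
proof (induction Cs arbitrary: a)
  case Nil
  then show ?case by (simp add: dominates_def)
next
  case (Cons C Cs)
  show ?case
  proof (cases "\<exists>b\<in>set C. a \<le> b")
    case True
    define b where "b = Min {b \<in> set C. a \<le> b}"
    note b = Min_ge_props[OF finite_set True, folded b_def]
    define C' where "C' = map (\<lambda>x. if x = b then a else x) C"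
    have ins: "column_insert a (C # Cs) = C' # column_insert b Cs"
      using True by (simp add: b_def C'_def Let_def)
    have new: "a \<notin> set C \<or> a = b" using b by force
    have C': "set C' = insert a (set C - {b})" using b by (auto simp: C'_def image_iff)
    have "inj_on (\<lambda>x. if x = b then a else x) (set C)" using new by (auto simp: inj_on_def)
    then have "distinct C'" using Cons.prems by (simp add: C'_def distinct_map)
    moreover have "dominates (set C') (head_entries (column_insert b Cs))"
      unfolding C' head_entries_column_insert
      using Cons.prems b new by (intro dominates_replace) auto
    ultimately show ?thesis using Cons by (auto simp: ins simp del: column_insert.simps)
  next
    case False
    then have "a \<notin> set C" by auto
    moreover have "card {y \<in> set C. y < x} \<le> card {y. (y = a \<or> y \<in> set C) \<and> y < x}" for x
      by (rule card_mono) auto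
    ultimately show ?thesis using Cons.prems False
      by (auto simp: dominates_def intro: order_trans)
  qed
qed

text \<open>A threshold above all entries turns the domination of adjacent columns into a comparison of their
  lengths.\<close>

lemma tableau_columns_lengths: "tableau_columns Cs \<Longrightarrow> sorted_wrt (\<ge>) (map length Cs)"
proof (induction Cs)
  case Nil
  then show ?case by simp
next
  case (Cons C Cs)
  show ?case
  proof (cases Cs)
    case Nil
    then show ?thesis by simp
  next
    case (Cons D Ds)
    obtain x where x: "\<And>y. y \<in> set C \<union> set D \<Longrightarrow> y < x"
      using finite_nat_set_iff_bounded[of "set C \<union> set D"] by auto
    have "{y \<in> set C. y < x} = set C" "{y \<in> set D. y < x} = set D" using x by auto
    moreover have "card {y \<in> set D. y < x} \<le> card {y \<in> set C. y < x}"
      using Cons.prems Cons by (simp add: dominates_def)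
    ultimately have "length D \<le> length C"
      using Cons.prems Cons by (simp add: distinct_card)
    then show ?thesis using Cons.IH Cons.prems Cons by auto
  qed
qed

lemma length_initial_column [simp]: "length (initial_column l) = l"
  by (simp add: initial_column_def)

lemma set_initial_column [simp]: "set (initial_column l) = {1..l}"
  by (auto simp: initial_column_def)

lemma distinct_initial_column [simp]: "distinct (initial_column l)"
  by (simp add: initial_column_def)

lemma initial_column_Suc: "initial_column (Suc l) = initial_column l @ [Suc l]"
  by (simp add: initial_column_def)

lemma append_eq_initial_column:
  assumes "C @ [a] = initial_column l"
  shows "C = initial_column (l - 1)" "l = a" "1 \<le> l"
proof -
  have "l \<noteq> 0" using assms by (metis length_append_singleton length_initial_column nat.simps(3))
  then obtain k where "l = Suc k" by (cases l) auto
  then show "C = initial_column (l - 1)" "l = a" "1 \<le> l" using assms by (auto simp: initial_column_Suc)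
qed

lemma tableau_columns_initial_columns: "sorted_wrt (\<ge>) ls \<Longrightarrow> tableau_columns (map initial_column ls)"
proof (induction ls)
  case Nil
  then show ?case by simp
next
  case (Cons l ls)
  have "dominates {1..l} (head_entries (map initial_column ls))"
  proof (cases ls)
    case Nil
    then show ?thesis by (simp add: dominates_def)
  next
    case (Cons k ks)
    then have "k \<le> l" using Cons.prems by auto
    then show ?thesis using Cons by (auto simp: dominates_def intro!: card_mono)
  qed
  then show ?case using Cons by auto
qed

lemma column_insert_contains: "\<exists>C\<in>set (column_insert a Cs). a \<in> set C"
  by (cases Cs) (use Min_ge_props(1) in \<open>auto simp: Let_def\<close>)

text \<open>A letter \<open>b\<close> bumped out of the first column occurs in a later column of the result, so it is
  at most the length of the first column, which is the longest one. Were \<open>b\<close> different from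
  \<open>a\<close>, then \<open>b\<close> would be missing from the first column of the result, which nevertheless
  contains all numbers up to its length. So nothing changes in the first column.\<close>

lemma column_insert_eq_initial_columnsD:
  assumes "column_insert a Cs = map initial_column ms" "sorted_wrt (\<ge>) ms"
  shows "\<exists>ls. Cs = map initial_column ls"
  using assms
proof (induction Cs arbitrary: a ms)
  case Nil
  show ?case by (intro exI[of _ "[]"]) simp
next
  case (Cons C Cs)
  show ?case
  proof (cases "\<exists>b\<in>set C. a \<le> b")
    case True
    define b where "b = Min {b \<in> set C. a \<le> b}"
    note b = Min_ge_props[OF finite_set True, folded b_def]
    obtain k ks where ms: "ms = k # ks" and C: "map (\<lambda>x. if x = b then a else x) C = initial_column k"
      and Cs: "column_insert b Cs = map initial_column ks"
      using Cons.prems True by (cases ms) (auto simp: b_def Let_def)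
    obtain D where "D \<in> set (map initial_column ks)" "b \<in> set D"
      using column_insert_contains[of b Cs] unfolding Cs by blast
    then have "b \<in> set (initial_column k)" using Cons.prems(2) ms by force
    then have "a = b" unfolding C[symmetric] by (auto split: if_splits)
    then have "map (\<lambda>x. if x = b then a else x) C = C" by (intro map_idI) auto
    moreover obtain ls where "Cs = map initial_column ls" using Cons.IH[OF Cs] Cons.prems(2) ms by auto
    ultimately have "C # Cs = map initial_column (k # ls)" using C by simp
    then show ?thesis by (rule exI)
  next
    case False
    then obtain k ks where "C @ [a] = initial_column k" "Cs = map initial_column ks"
      using Cons.prems by (cases ms) auto
    then have "C # Cs = map initial_column ((k - 1) # ks)"
      using append_eq_initial_column(1) by auto
    then show ?thesis by (rule exI)
  qed
qed

text \<open>Since \<^const>\<open>tableau_columns\<close> keeps the column lengths sorted at every stage, the previous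
  lemma applies to all insertions from the last one back to the first. So insertion never returns to the highest
  weight tableaux once it has left them.\<close>

lemma fold_column_insert_eq_initial_columnsD:
  assumes "tableau_columns Cs" "fold column_insert w Cs = map initial_column ms"
  shows "\<exists>ls. Cs = map initial_column ls"
  using assms
proof (induction w arbitrary: Cs)
  case Nil
  then show ?case by auto
next
  case (Cons a w)
  then obtain ks where ks: "column_insert a Cs = map initial_column ks"
    using tableau_columns_column_insert by fastforce
  then have "sorted_wrt (\<ge>) ks"
    using tableau_columns_lengths[OF tableau_columns_column_insert[OF Cons.prems(1), of a]] by (simp add: comp_def)
  then show ?case using column_insert_eq_initial_columnsD ks by blast
qed

fun add_box :: "nat \<Rightarrow> nat list \<Rightarrow> nat list" where
  "add_box a [] = [a]"
| "add_box a (l # ls) = (if a \<le> l then l # add_box a ls else a # ls)"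

definition addable :: "nat \<Rightarrow> nat list \<Rightarrow> bool" where
  "addable a ls \<longleftrightarrow> a = 1 \<or> row_length ls a < row_length ls (a - 1)"

lemma row_length_Nil [simp]: "row_length [] a = 0"
  by (simp add: row_length_def)

lemma row_length_Cons [simp]: "row_length (l # ls) a = (if a \<le> l then 1 else 0) + row_length ls a"
  by (simp add: row_length_def)

lemma row_length_antimono: "a \<le> b \<Longrightarrow> row_length ls b \<le> row_length ls a"
  by (induction ls) auto

lemma row_length_eq_0: "\<forall>l\<in>set ls. l < a \<Longrightarrow> row_length ls a = 0"
  by (induction ls) auto

lemma column_insert_initial:
  assumes "1 \<le> a"
  shows "column_insert a (initial_column l # Cs) =
    (if a \<le> l then initial_column l # column_insert a Cs else (initial_column l @ [a]) # Cs)"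
proof (cases "a \<le> l")
  case True
  then have "\<exists>b\<in>set (initial_column l). a \<le> b" using assms by auto
  moreover have "Min {b \<in> set (initial_column l). a \<le> b} = a"
    using assms True by (intro Min_eqI) auto
  moreover have "map (\<lambda>x. if x = a then a else x) (initial_column l) = initial_column l"
    by (intro map_idI) auto
  ultimately show ?thesis using True by (simp add: Let_def del: set_initial_column)
next
  case False
  then show ?thesis by auto
qed

lemma addable_Cons_less:
  assumes "sorted_wrt (\<ge>) (l # ls)" "addable a (l # ls)" "1 \<le> l" "l < a"
  shows "a = Suc l"
proof (rule ccontr)
  assume "a \<noteq> Suc l"
  then have "\<forall>k\<in>set (l # ls). k < a - 1" using assms by force
  then have "row_length (l # ls) (a - 1) = 0" by (rule row_length_eq_0)
  then show False using assms by (auto simp: addable_def)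
qed

lemma addable_Cons_ge: "a \<le> l \<Longrightarrow> addable a (l # ls) \<longleftrightarrow> addable a ls"
  by (auto simp: addable_def)

lemma column_insert_addable:
  assumes "sorted_wrt (\<ge>) ls" "\<forall>l\<in>set ls. 1 \<le> l" "1 \<le> a" "addable a ls"
  shows "column_insert a (map initial_column ls) = map initial_column (add_box a ls)"
  using assms
proof (induction ls)
  case Nil
  then show ?case by (simp add: addable_def initial_column_def)
next
  case (Cons l ls)
  then show ?case using addable_Cons_less[of l ls a]
    by (auto simp: column_insert_initial addable_Cons_ge initial_column_Suc simp del: column_insert.simps)
qed

lemma column_insert_addableD:
  assumes "sorted_wrt (\<ge>) ls" "\<forall>l\<in>set ls. 1 \<le> l" "1 \<le> a"
    and "column_insert a (map initial_column ls) = map initial_column ms"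
  shows "addable a ls"
  using assms
proof (induction ls arbitrary: ms)
  case Nil
  then obtain k where "[] @ [a] = initial_column k" by auto
  from append_eq_initial_column[OF this] show ?case
    by (auto simp: addable_def dest: arg_cong[where f = length])
next
  case (Cons l ls)
  show ?case
  proof (cases "a \<le> l")
    case True
    then show ?thesis using Cons
      by (cases ms) (auto simp: column_insert_initial addable_Cons_ge simp del: column_insert.simps)
  next
    case False
    then obtain k where k: "initial_column l @ [a] = initial_column k"
      using Cons.prems by (cases ms) (auto simp: column_insert_initial simp del: column_insert.simps)
    have "l = a - 1"
      using arg_cong[OF append_eq_initial_column(1)[OF k], of length] append_eq_initial_column(2)[OF k] by simp
    moreover have "row_length ls a = 0" using False Cons.prems by (intro row_length_eq_0) auto
    ultimately show ?thesis using False by (auto simp: addable_def)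
  qed
qed

lemma add_box_props:
  assumes "sorted_wrt (\<ge>) ls" "\<forall>l\<in>set ls. 1 \<le> l" "1 \<le> a" "addable a ls"
  shows "sorted_wrt (\<ge>) (add_box a ls)" "\<forall>l\<in>set (add_box a ls). 1 \<le> l"
    "1 \<le> b \<Longrightarrow> row_length (add_box a ls) b = row_length ls b + (if b = a then 1 else 0)"
proof -
  have sub: "set (add_box a ks) \<subseteq> insert a (set ks)" for ks
    by (induction ks) auto
  show "\<forall>l\<in>set (add_box a ls). 1 \<le> l" using sub[of ls] assms by auto
  show "sorted_wrt (\<ge>) (add_box a ls)" using assms(1)
  proof (induction ls)
    case (Cons l ls)
    then show ?case using sub[of ls] by fastforce
  qed simp
  show "row_length (add_box a ls) b = row_length ls b + (if b = a then 1 else 0)" if "1 \<le> b"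
    using assms
  proof (induction ls)
    case Nil
    then show ?case using that by (auto simp: addable_def)
  next
    case (Cons l ls)
    then show ?case using addable_Cons_less[of l ls a] by (auto simp: addable_Cons_ge)
  qed
qed

text \<open>The number of columns of length \<open>a\<close> is the difference of the lengths of rows \<open>a\<close>
  and \<open>a + 1\<close>.\<close>

lemma row_length_inject:
  assumes "sorted_wrt (\<ge>) ls" "\<forall>l\<in>set ls. 1 \<le> l" "sorted_wrt (\<ge>) ms" "\<forall>l\<in>set ms. 1 \<le> l"
    and eq: "\<And>a. 1 \<le> a \<Longrightarrow> row_length ls a = row_length ms a"
  shows "ls = ms"
proof -
  have "row_length ks a = row_length ks (Suc a) + count (mset ks) a" for ks a
    by (induction ks) auto
  then have "count (mset ls) a = count (mset ms) a" if "1 \<le> a" for a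
    using eq[of a] eq[of "Suc a"] that by (metis add_left_cancel le_SucI)
  moreover have "count (mset ls) 0 = count (mset ms) 0"
    using assms by (metis count_eq_zero_iff not_one_le_zero set_mset_mset)
  ultimately have "mset (rev ls) = mset (rev ms)"
    by (intro multiset_eqI) (metis One_nat_def mset_rev not_less_eq_eq le_zero_eq)
  moreover have "sorted (rev ls)" "sorted (rev ms)" using assms by (auto simp: sorted_wrt_rev)
  ultimately show ?thesis using properties_for_sort[of "rev ls" "rev ms"] by (metis rev_rev_ident sorted_sort_id)
qed

text \<open>As long as every letter can be added to the end of its own row, insertion adds the corresponding box. The
  first letter for which this fails leads out of the highest weight tableaux, for good. So the inequality says that
  the initial rows together with the contents of each prefix of \<open>w\<close> form a partition.\<close>

lemma fold_column_insert_initial_iff: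
  assumes "sorted_wrt (\<ge>) ls" "\<forall>l\<in>set ls. 1 \<le> l" "sorted_wrt (\<ge>) ms" "\<forall>l\<in>set ms. 1 \<le> l"
    and "\<forall>a\<in>set w. 1 \<le> a"
  shows "fold column_insert w (map initial_column ls) = map initial_column ms \<longleftrightarrow>
    (\<forall>n. \<forall>a\<ge>1. row_length ls (Suc a) + count_list (take n w) (Suc a)
                \<le> row_length ls a + count_list (take n w) a) \<and>
    (\<forall>a\<ge>1. row_length ls a + count_list w a = row_length ms a)"
    (is "?L ls w \<longleftrightarrow> ?P ls w \<and> ?C ls w")
  using assms
proof (induction w arbitrary: ls)
  case Nil
  have inj: "inj initial_column" by (metis injI length_initial_column)
  show ?case using Nil row_length_inject[of ls ms] row_length_antimono[of _ "Suc _" ls]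
    by (auto simp: inj_map_eq_map[OF inj])
next
  case (Cons x w)
  have x: "1 \<le> x" using Cons.prems by simp
  show ?case
  proof (cases "addable x ls")
    case True
    note ab = add_box_props[OF Cons.prems(1,2) x True]
    have "?L ls (x # w) \<longleftrightarrow> ?L (add_box x ls) w"
      using column_insert_addable[OF Cons.prems(1,2) x True] by simp
    also have "\<dots> \<longleftrightarrow> ?P (add_box x ls) w \<and> ?C (add_box x ls) w"
      using Cons.prems ab by (intro Cons.IH) auto
    also have "?C (add_box x ls) w \<longleftrightarrow> ?C ls (x # w)"
      using ab(3) by auto
    also have "?P (add_box x ls) w \<longleftrightarrow> ?P ls (x # w)"
    proof -
      have step: "row_length (add_box x ls) a + count_list (take n w) a
          = row_length ls a + count_list (take (Suc n) (x # w)) a" if "1 \<le> a" for a n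
        using ab(3)[OF that] by auto
      have "?P (add_box x ls) w \<longleftrightarrow> (\<forall>n. \<forall>a\<ge>1. row_length ls (Suc a) + count_list (take (Suc n) (x # w)) (Suc a)
                \<le> row_length ls a + count_list (take (Suc n) (x # w)) a)"
        using step by simp
      also have "\<dots> \<longleftrightarrow> ?P ls (x # w)"
      proof (intro iffI allI impI)
        fix n a :: nat
        assume *: "\<forall>n. \<forall>a\<ge>1. row_length ls (Suc a) + count_list (take (Suc n) (x # w)) (Suc a)
                \<le> row_length ls a + count_list (take (Suc n) (x # w)) a" and a: "1 \<le> a"
        show "row_length ls (Suc a) + count_list (take n (x # w)) (Suc a)
                \<le> row_length ls a + count_list (take n (x # w)) a"
        proof (cases n)
          case 0
          then show ?thesis using row_length_antimono[of a "Suc a" ls] by simp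
        next
          case (Suc k)
          then show ?thesis using *[rule_format, OF a, of k] by simp
        qed
      next
        fix n a :: nat
        assume *: "?P ls (x # w)" and a: "1 \<le> a"
        show "row_length ls (Suc a) + count_list (take (Suc n) (x # w)) (Suc a)
                \<le> row_length ls a + count_list (take (Suc n) (x # w)) a"
          using *[rule_format, OF a, of "Suc n"] .
      qed
      finally show ?thesis .
    qed
    finally show ?thesis .
  next
    case False
    have "\<not> ?L ls (x # w)"
    proof
      assume "?L ls (x # w)"
      then have "fold column_insert w (column_insert x (map initial_column ls)) = map initial_column ms"
        by simp
      from fold_column_insert_eq_initial_columnsD[OF tableau_columns_column_insert[OF tableau_columns_initial_columns[OF Cons.prems(1)]] this]
      show False using column_insert_addableD[OF Cons.prems(1,2) x] False by blast
    qed
    moreover have "\<not> ?P ls (x # w)"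
    proof
      assume "?P ls (x # w)"
      then have "row_length ls x + count_list (take 1 (x # w)) x
          \<le> row_length ls (x - 1) + count_list (take 1 (x # w)) (x - 1)" if "x \<noteq> 1"
      proof -
        obtain y where y: "x = Suc y" "1 \<le> y" using \<open>x \<noteq> 1\<close> x by (cases x) auto
        show ?thesis using \<open>?P ls (x # w)\<close>[rule_format, of y 1] y by simp
      qed
      then show False using False x by (auto simp: addable_def split: if_splits)
    qed
    ultimately show ?thesis by blast
  qed
qed

section \<open>Columns of highest weight tableaux\<close>

lemma initial_segment_eq:
  fixes J :: "nat set"
  assumes "finite J" "\<And>j. j \<in> J \<Longrightarrow> l < j" "\<And>j j'. j \<in> J \<Longrightarrow> l < j' \<Longrightarrow> j' \<le> j \<Longrightarrow> j' \<in> J"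
  shows "J = {l<..l + card J}"
proof (cases "J = {}")
  case False
  have "Max J \<in> J" using assms False by simp
  then have "J = {l<..Max J}"
    using assms(2) assms(3)[of "Max J"] Max_ge[OF assms(1)] by (intro set_eqI iffI) auto
  moreover have "l < Max J" using assms False by simp
  ultimately show ?thesis by (metis card_greaterThanAtMost le_add_diff_inverse less_imp_le)
qed simp

lemma part_antimono: "is_partition nu \<Longrightarrow> 1 \<le> i \<Longrightarrow> i \<le> i' \<Longrightarrow> part nu i' \<le> part nu i"
  by (cases "i = i'") (auto simp: is_partition_def Defs.part_def sorted_wrt_iff_nth_less)

lemma le_part_iff_le_conj_part:
  assumes "is_partition nu" "1 \<le> i" "1 \<le> j"
  shows "j \<le> part nu i \<longleftrightarrow> i \<le> conj_part nu j"
proof -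
  define A where "A = {i \<in> {1..length nu}. j \<le> part nu i}"
  have "A = {0<..0 + card A}"
    using part_antimono[OF assms(1)] by (intro initial_segment_eq) (auto simp: A_def Suc_le_eq intro: order_trans)
  then have "i \<in> A \<longleftrightarrow> i \<in> {0<..0 + card A}" by (rule arg_cong)
  then have "i \<in> A \<longleftrightarrow> i \<le> card A" using assms by auto
  moreover have "i \<in> A \<longleftrightarrow> j \<le> part nu i" using assms by (auto simp: A_def Defs.part_def)
  ultimately show ?thesis by (simp add: conj_part_def A_def)
qed

definition column_lengths :: "nat list \<Rightarrow> nat list" where
  "column_lengths nu = map (conj_part nu) [1..<Suc (part nu 1)]"

lemma mem_diagram_iff: "(i, j) \<in> diagram nu \<longleftrightarrow> 1 \<le> i \<and> 1 \<le> j \<and> j \<le> part nu i"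
  by (auto simp: diagram_def Defs.part_def)

lemma columns_H_tableau:
  assumes "is_partition nu"
  shows "columns (H_tableau nu) = map initial_column (column_lengths nu)"
proof -
  have sh: "shape (H_tableau nu) = diagram nu"
    by (auto simp: shape_def H_tableau_def mem_diagram_iff split: if_splits)
  have "snd ` diagram nu = {1..<Suc (part nu 1)}"
  proof
    show "snd ` diagram nu \<subseteq> {1..<Suc (part nu 1)}"
      using part_antimono[OF assms, of 1] by (force simp: mem_diagram_iff)
    show "{1..<Suc (part nu 1)} \<subseteq> snd ` diagram nu"
      by (auto simp: mem_diagram_iff image_iff intro!: bexI[of _ "(1, _)"])
  qed
  moreover have "map (\<lambda>i. H_tableau nu (i, j)) (sorted_list_of_set {i. (i, j) \<in> diagram nu})
      = initial_column (conj_part nu j)" if "1 \<le> j" for j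
  proof -
    have "{i. (i, j) \<in> diagram nu} = {1..<Suc (conj_part nu j)}"
      using that le_part_iff_le_conj_part[OF assms] by (auto simp: mem_diagram_iff)
    moreover have "H_tableau nu (i, j) = i" if "i \<in> {1..<Suc (conj_part nu j)}" for i
      using that \<open>1 \<le> j\<close> le_part_iff_le_conj_part[OF assms] by (auto simp: H_tableau_def mem_diagram_iff)
    ultimately show ?thesis
      by (auto simp: initial_column_def simp del: upt_Suc intro!: map_idI)
  qed
  ultimately show ?thesis by (auto simp: columns_def sh column_lengths_def simp del: upt_Suc)
qed

lemma column_lengths_sorted: "sorted_wrt (\<ge>) (column_lengths nu)"
proof -
  have "conj_part nu j' \<le> conj_part nu j" if "j < j'" for j j'
    unfolding conj_part_def using that by (intro card_mono) auto
  then show ?thesis unfolding column_lengths_def sorted_wrt_map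
    by (intro sorted_wrt_mono_rel[OF _ sorted_wrt_upt]) auto
qed

lemma column_lengths_pos: "is_partition nu \<Longrightarrow> \<forall>l\<in>set (column_lengths nu). 1 \<le> l"
  using le_part_iff_le_conj_part[of nu 1] by (fastforce simp: column_lengths_def simp del: upt_Suc)

lemma row_length_column_lengths:
  assumes "is_partition nu" "1 \<le> a"
  shows "row_length (column_lengths nu) a = part nu a"
proof -
  have "row_length (column_lengths nu) a = length (filter (\<lambda>j. a \<le> conj_part nu j) [1..<Suc (part nu 1)])"
    by (simp add: row_length_def column_lengths_def filter_map comp_def del: upt_Suc)
  also have "\<dots> = card ({j. a \<le> conj_part nu j} \<inter> {1..<Suc (part nu 1)})"
    by (subst distinct_length_filter) (simp_all del: upt_Suc)
  also have "{j. a \<le> conj_part nu j} \<inter> {1..<Suc (part nu 1)} = {1..part nu a}"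
    using part_antimono[OF assms(1), of 1 a] assms le_part_iff_le_conj_part[OF assms] by auto
  finally show ?thesis by simp
qed

section \<open>Ballot conditions on column readings\<close>

text \<open>The order in which cells are read, for a row coordinate \<open>r\<close> and a column coordinate
  \<open>c\<close>. The coordinates are integers so that the reversed reading order is obtained by negating both;
  thereby one lemma serves the prefixes as well as the suffixes of a reading word.\<close>

definition precedes :: "('a \<Rightarrow> int) \<Rightarrow> ('a \<Rightarrow> int) \<Rightarrow> 'a \<Rightarrow> 'a \<Rightarrow> bool" where
  "precedes r c x y \<longleftrightarrow> c y < c x \<or> c x = c y \<and> r x < r y"

definition reading_cells :: "tableau \<Rightarrow> (nat \<times> nat) list" where
  "reading_cells T = concat (map (\<lambda>j. map (\<lambda>i. (i, j)) (sorted_list_of_set {i. (i, j) \<in> shape T}))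
     (rev (sorted_list_of_set (snd ` shape T))))"

lemma reading_word_eq: "reading_word T = map T (reading_cells T)"
  by (simp add: reading_word_def reading_cells_def columns_def rev_map map_concat comp_def)

lemma finite_column:
  "finite (shape T) \<Longrightarrow> finite {i. (i, j) \<in> shape T}"
  by (rule finite_subset[of _ "fst ` shape T"]) force+

lemma set_reading_cells: "finite (shape T) \<Longrightarrow> set (reading_cells T) = shape T"
  by (force simp: reading_cells_def finite_column)

lemma sorted_wrt_reading_cells:
  "sorted_wrt (precedes (\<lambda>x. int (fst x)) (\<lambda>x. int (snd x))) (reading_cells T)"
proof -
  have "sorted_wrt (precedes (\<lambda>x. int (fst x)) (\<lambda>x. int (snd x)))
      (concat (map (\<lambda>j. map (\<lambda>i. (i, j)) (sorted_list_of_set {i. (i, j) \<in> shape T})) js))"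
    if "sorted_wrt (>) js" for js
    using that
  proof (induction js)
    case (Cons j js)
    have "sorted_wrt (precedes (\<lambda>x. int (fst x)) (\<lambda>x. int (snd x)))
        (map (\<lambda>i. (i, j)) (sorted_list_of_set {i. (i, j) \<in> shape T}))"
      unfolding sorted_wrt_map
      by (rule sorted_wrt_mono_rel[OF _ strict_sorted_list_of_set]) (auto simp: precedes_def)
    moreover have "precedes (\<lambda>x. int (fst x)) (\<lambda>x. int (snd x)) x y"
      if "x \<in> set (map (\<lambda>i. (i, j)) (sorted_list_of_set {i. (i, j) \<in> shape T}))"
        "y \<in> set (concat (map (\<lambda>j. map (\<lambda>i. (i, j)) (sorted_list_of_set {i. (i, j) \<in> shape T})) js))" for x y
      using that Cons.prems by (auto simp: precedes_def)
    ultimately show ?case using Cons unfolding list.map concat.simps sorted_wrt_append by auto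
  qed simp
  moreover have "sorted_wrt (>) (rev (sorted_list_of_set (snd ` shape T)))"
    by (simp add: sorted_wrt_rev)
  ultimately show ?thesis unfolding reading_cells_def .
qed

text \<open>The inequality can become false only at a position where \<open>b\<close> is read.\<close>

lemma prefix_inequality_iff:
  fixes w :: "nat list"
  assumes "a \<noteq> b"
  shows "(\<forall>n. g + count_list (take n w) b \<le> f + count_list (take n w) a) \<longleftrightarrow>
    g \<le> f \<and> (\<forall>k<length w. w ! k = b \<longrightarrow>
      g + count_list (take (Suc k) w) b \<le> f + count_list (take (Suc k) w) a)"
    (is "(\<forall>n. ?P n) \<longleftrightarrow> ?R")
proof
  assume "\<forall>n. ?P n"
  then show ?R using spec[OF \<open>\<forall>n. ?P n\<close>, of 0] by auto
next
  assume R: ?R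
  show "\<forall>n. ?P n"
  proof
    fix n
    show "?P n"
    proof (induction n)
      case 0
      then show ?case using R by simp
    next
      case (Suc n)
      show ?case
      proof (cases "n < length w \<and> w ! n = b")
        case True
        then show ?thesis using R by blast
      next
        case False
        then show ?thesis using Suc by (cases "n < length w") (auto simp: take_Suc_conv_app_nth)
      qed
    qed
  qed
qed

lemma count_list_map_distinct:
  "distinct cs \<Longrightarrow> count_list (map T cs) v = card {x \<in> set cs. T x = v}"
proof (induction cs)
  case (Cons c cs)
  have "{x \<in> set (c # cs). T x = v} = (if T c = v then insert c {x \<in> set cs. T x = v} else {x \<in> set cs. T x = v})"
    by auto
  then show ?case using Cons by simp
qed simp

lemma set_take_Suc_sorted_wrt_precedes:
  assumes "sorted_wrt (precedes r c) cs" "k < length cs"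
  shows "set (take (Suc k) cs) = {x \<in> set cs. x = cs ! k \<or> precedes r c x (cs ! k)}"
proof -
  have irr: "\<not> precedes r c x x" and asym: "precedes r c x y \<Longrightarrow> \<not> precedes r c y x" for x y
    by (auto simp: precedes_def)
  have lt: "i < j \<Longrightarrow> j < length cs \<Longrightarrow> precedes r c (cs ! i) (cs ! j)" for i j
    using assms(1) by (simp add: sorted_wrt_iff_nth_less)
  have before: "cs ! j = cs ! k \<or> precedes r c (cs ! j) (cs ! k) \<longleftrightarrow> j < Suc k" if "j < length cs" for j
    using lt[of j k] lt[of k j] that assms(2) irr[of "cs ! k"] asym[of "cs ! k" "cs ! j"]
    by (cases j k rule: linorder_cases) auto
  have "{j. j < length cs \<and> (cs ! j = cs ! k \<or> precedes r c (cs ! j) (cs ! k))} = {0..<Suc k}"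
    using assms(2) by (intro set_eqI) (simp add: before cong: conj_cong, linarith)
  moreover have "{x \<in> set cs. P x} = (!) cs ` {j. j < length cs \<and> P (cs ! j)}" for P
    by (auto simp: set_conv_nth)
  moreover have "set (take (Suc k) cs) = (!) cs ` {0..<Suc k}"
    using assms(2) by (intro nth_image[symmetric]) simp
  ultimately show ?thesis by presburger
qed

text \<open>The row condition for \<open>i\<close> follows from the prefix condition at the leftmost entry
  \<open>b\<close> of the last row up to \<open>i\<close> in which \<open>b\<close> occurs: by \<open>XX\<close> all
  entries \<open>b\<close> in the rows up to \<open>i\<close> have been read there, and by \<open>XY\<close> the
  entries \<open>a\<close> read so far lie in earlier rows. Conversely, the prefix that ends at an arbitrary entry
  \<open>b\<close> misses, compared with the condition for its row, the \<open>b\<close>'s further left in this row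
  and the \<open>a\<close>'s further left in earlier rows. By \<open>fill\<close> and \<open>YY\<close> the latter lie
  above some of the former, in distinct columns. So at most as many \<open>a\<close>'s as \<open>b\<close>'s are
  missing, and the inequality persists.\<close>

lemma column_prefix_iff_row_prefix:
  fixes T :: "'a \<Rightarrow> nat" and r c :: "'a \<Rightarrow> int"
  assumes sorted: "sorted_wrt (precedes r c) cs" and "a \<noteq> b"
  defines "X \<equiv> {x \<in> set cs. T x = b}" and "Y \<equiv> {x \<in> set cs. T x = a}"
  assumes XX: "\<And>x x'. x \<in> X \<Longrightarrow> x' \<in> X \<Longrightarrow> r x < r x' \<Longrightarrow> c x' < c x"
    and YY: "inj_on c Y"
    and XY: "\<And>x y. x \<in> X \<Longrightarrow> y \<in> Y \<Longrightarrow> r x \<le> r y \<Longrightarrow> c y < c x"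
    and fill: "\<And>x y. x \<in> X \<Longrightarrow> y \<in> Y \<Longrightarrow> r y < r x \<Longrightarrow> c y < c x \<Longrightarrow> \<exists>x'\<in>X. r x' = r x \<and> c x' = c y"
  shows "(\<forall>n. g + count_list (take n (map T cs)) b \<le> f + count_list (take n (map T cs)) a) \<longleftrightarrow>
    (\<forall>i. g + card {x \<in> X. r x \<le> i} \<le> f + card {y \<in> Y. r y < i})"
proof -
  have fin: "finite X" "finite Y" by (auto simp: X_def Y_def)
  have "distinct cs"
    using sorted by (auto simp: distinct_conv_nth sorted_wrt_iff_nth_less precedes_def)
      (metis linorder_neqE_nat order_less_irrefl)
  have linear: "x = y \<or> precedes r c x y \<or> precedes r c y x" if "x \<in> set cs" "y \<in> set cs" for x y
    using that sorted by (metis in_set_conv_nth linorder_neqE_nat sorted_wrt_iff_nth_less)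
  define PX where "PX x = {z \<in> X. z = x \<or> precedes r c z x}" for x
  define PY where "PY x = {y \<in> Y. y = x \<or> precedes r c y x}" for x
  have cnt: "count_list (take (Suc k) (map T cs)) v
      = card {x \<in> set cs. T x = v \<and> (x = cs ! k \<or> precedes r c x (cs ! k))}" if "k < length cs" for k v
    using count_list_map_distinct[of "take (Suc k) cs" T v] \<open>distinct cs\<close> that
    unfolding take_map set_take_Suc_sorted_wrt_precedes[OF sorted that]
    by (auto simp: conj_ac intro!: arg_cong[of _ _ card])
  have "(\<forall>n. g + count_list (take n (map T cs)) b \<le> f + count_list (take n (map T cs)) a) \<longleftrightarrow>
      g \<le> f \<and> (\<forall>k<length cs. T (cs ! k) = b \<longrightarrow> g + card (PX (cs ! k)) \<le> f + card (PY (cs ! k)))"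
    unfolding prefix_inequality_iff[OF \<open>a \<noteq> b\<close>] PX_def PY_def X_def Y_def
    using cnt by (simp add: conj_ac cong: conj_cong)
  also have "\<dots> \<longleftrightarrow> g \<le> f \<and> (\<forall>x\<in>X. g + card (PX x) \<le> f + card (PY x))"
    by (auto simp: X_def in_set_conv_nth)
  also have "\<dots> \<longleftrightarrow> (\<forall>i. g + card {x \<in> X. r x \<le> i} \<le> f + card {y \<in> Y. r y < i})"
  proof (intro iffI allI conjI ballI)
    fix i
    assume col: "g \<le> f \<and> (\<forall>x\<in>X. g + card (PX x) \<le> f + card (PY x))"
    show "g + card {x \<in> X. r x \<le> i} \<le> f + card {y \<in> Y. r y < i}"
    proof (cases "{x \<in> X. r x \<le> i} = {}")
      case True
      then show ?thesis unfolding True using col by simp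
    next
      case False
      \<comment> \<open>The last row up to \<open>i\<close> that meets \<open>X\<close>.\<close>
      define i0 where "i0 = Max (r ` {x \<in> X. r x \<le> i})"
      have "i0 \<in> r ` {x \<in> X. r x \<le> i}" unfolding i0_def using False fin by (intro Max_in) auto
      then obtain x1 where x1: "x1 \<in> X" "r x1 = i0" "i0 \<le> i" by auto
      have i0_max: "r z \<le> i0" if "z \<in> X" "r z \<le> i" for z
        unfolding i0_def using that fin by (intro Max_ge) auto
      obtain x where x: "x \<in> X" "r x = i0" and left: "\<And>z. z \<in> X \<Longrightarrow> r z = i0 \<Longrightarrow> c x \<le> c z"
      proof -
        have "Min (c ` {z \<in> X. r z = i0}) \<in> c ` {z \<in> X. r z = i0}"
          using fin x1 by (intro Min_in) auto
        then obtain x where "x \<in> X" "r x = i0" "c x = Min (c ` {z \<in> X. r z = i0})" by auto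
        then show ?thesis using that[of x] fin by auto
      qed
      have "{x \<in> X. r x \<le> i} \<subseteq> PX x"
      proof
        fix z assume "z \<in> {x \<in> X. r x \<le> i}"
        then have z: "z \<in> X" "r z \<le> i0" using i0_max by auto
        then show "z \<in> PX x"
          using XX[OF z(1) x(1)] left[OF z(1)] x linear[of z x] unfolding PX_def X_def precedes_def by fastforce
      qed
      then have "card {x \<in> X. r x \<le> i} \<le> card (PX x)" using fin by (intro card_mono) (auto simp: PX_def)
      moreover have "PY x \<subseteq> {y \<in> Y. r y < i}"
      proof
        fix y assume "y \<in> PY x"
        then have y: "y \<in> Y" "c x \<le> c y"
          by (auto simp: PY_def precedes_def)
        then show "y \<in> {y \<in> Y. r y < i}" using XY[OF x(1) y(1)] x x1 by force
      qed
      then have "card (PY x) \<le> card {y \<in> Y. r y < i}" using fin by (intro card_mono) auto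
      ultimately show ?thesis using col x by fastforce
    qed
  next
    assume row: "\<forall>i. g + card {x \<in> X. r x \<le> i} \<le> f + card {y \<in> Y. r y < i}"
    show "g \<le> f"
    proof -
      \<comment> \<open>A row before all rows of \<open>Y\<close>, so that the row condition reduces to
        \<open>g \<le> f\<close>.\<close>
      define i where "i = Min (insert 0 (r ` Y))"
      have "\<not> r y < i" if "y \<in> Y" for y
        using that fin unfolding i_def by (auto simp: not_less intro!: Min_le)
      then have "{y \<in> Y. r y < i} = {}" by auto
      then show ?thesis using spec[OF row, of i] by (simp only: card.empty)
    qed
    fix x assume x: "x \<in> X"
    \<comment> \<open>The entries of the row of \<open>x\<close> and of the earlier rows that the prefix up to
      \<open>x\<close> has not reached.\<close>
    define D where "D = {z \<in> X. r z = r x \<and> c z < c x}"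
    define E where "E = {y \<in> Y. r y < r x \<and> c y < c x}"
    have "card E \<le> card D"
    proof -
      have "c ` E \<subseteq> c ` D"
      proof
        fix j assume "j \<in> c ` E"
        then obtain y where y: "y \<in> Y" "r y < r x" "c y < c x" "j = c y" by (auto simp: E_def)
        then obtain x' where "x' \<in> X" "r x' = r x" "c x' = c y" using fill[OF x] by blast
        then show "j \<in> c ` D" using y by (intro image_eqI[of _ _ x']) (auto simp: D_def)
      qed
      then have "card (c ` E) \<le> card (c ` D)" using fin by (intro card_mono) (auto simp: D_def)
      moreover have "card (c ` D) \<le> card D" using fin by (intro card_image_le) (auto simp: D_def)
      moreover have "card (c ` E) = card E" by (intro card_image inj_on_subset[OF YY]) (auto simp: E_def)
      ultimately show ?thesis by simp
    qed
    moreover have "card (PX x) + card D \<le> card {z \<in> X. r z \<le> r x}"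
    proof -
      have "PX x \<inter> D = {}" by (auto simp: PX_def D_def precedes_def)
      moreover have "PX x \<union> D \<subseteq> {z \<in> X. r z \<le> r x}"
        using XX[OF x] by (force simp: PX_def D_def precedes_def)
      ultimately show ?thesis using fin card_mono[of "{z \<in> X. r z \<le> r x}" "PX x \<union> D"]
        by (simp add: card_Un_disjoint PX_def D_def)
    qed
    moreover have "card {y \<in> Y. r y < r x} \<le> card (PY x) + card E"
    proof -
      have "{y \<in> Y. r y < r x} \<subseteq> PY x \<union> E" by (auto simp: PY_def E_def precedes_def)
      then have "card {y \<in> Y. r y < r x} \<le> card (PY x \<union> E)" using fin by (intro card_mono) (auto simp: PY_def E_def)
      also have "\<dots> \<le> card (PY x) + card E" by (rule card_Un_le)
      finally show ?thesis .
    qed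
    ultimately show "g + card (PX x) \<le> f + card (PY x)" using spec[OF row, of "r x"] by linarith
  qed
  finally show ?thesis .
qed

section \<open>Order statistics and counting of cells\<close>

definition row_count :: "tableau \<Rightarrow> nat \<Rightarrow> nat \<Rightarrow> nat" where
  "row_count T i b = card {j. (i, j) \<in> shape T \<and> T (i, j) = b}"

text \<open>The \<open>t\<close>-th largest element, counted with multiplicity, of the multiset that contains
  \<open>f b\<close> copies of each \<open>b \<le> K\<close>.\<close>

definition kth_largest :: "nat \<Rightarrow> (nat \<Rightarrow> nat) \<Rightarrow> nat \<Rightarrow> nat" where
  "kth_largest K f t = (THE a. (\<Sum>b\<in>{a<..K}. f b) < t \<and> t \<le> (\<Sum>b\<in>{a..K}. f b))"

lemma kth_largest_eqI:
  assumes "(\<Sum>b\<in>{a<..K}. f b) < t" "t \<le> (\<Sum>b\<in>{a..K}. f b)"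
  shows "kth_largest K f t = a"
  unfolding kth_largest_def
proof (rule the_equality)
  have contra: False if "(\<Sum>b\<in>{a<..K}. f b) < t" "t \<le> (\<Sum>b\<in>{a'..K}. f b)" "a < a'" for a a'
  proof -
    have "(\<Sum>b\<in>{a'..K}. f b) \<le> (\<Sum>b\<in>{a<..K}. f b)" using that by (intro sum_mono2) auto
    then show False using that by simp
  qed
  show "a' = a" if "(\<Sum>b\<in>{a'<..K}. f b) < t \<and> t \<le> (\<Sum>b\<in>{a'..K}. f b)" for a'
    using contra[of a a'] contra[of a' a] assms that by (meson linorder_neqE_nat)
qed (use assms in auto)

lemma jth_smallest_props:
  assumes "finite J" "1 \<le> t" "t \<le> card J"
  shows "jth_smallest t J \<in> J" "card {j \<in> J. j < jth_smallest t J} = t - 1"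
    "card {j \<in> J. j \<le> jth_smallest t J} = t"
proof -
  define js where "js = sorted_list_of_set J"
  have js: "set js = J" "distinct js" "sorted_wrt (<) js" "length js = card J"
    using assms by (auto simp: js_def)
  have len: "t - 1 < length js" using assms js by simp
  then show mem: "jth_smallest t J \<in> J" using nth_mem[OF len] unfolding js(1) by (simp add: jth_smallest_def js_def)
  have lt: "js ! i < js ! j" if "i < j" "j < length js" for i j
    using js(3) that by (simp add: sorted_wrt_iff_nth_less)
  have iff: "js ! i < js ! (t - 1) \<longleftrightarrow> i < t - 1" if "i < length js" for i
    using lt[of i "t - 1"] lt[of "t - 1" i] len that by (cases i "t - 1" rule: linorder_cases) auto
  have "{j \<in> J. j < jth_smallest t J} = (!) js ` {i. i < length js \<and> js ! i < js ! (t - 1)}"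
    unfolding jth_smallest_def js_def[symmetric] by (auto simp: js(1)[symmetric] set_conv_nth)
  also have "{i. i < length js \<and> js ! i < js ! (t - 1)} = {..<t - 1}"
    using iff len by auto
  also have "card ((!) js ` {..<t - 1}) = t - 1"
    using js(2) len by (subst card_image) (auto simp: inj_on_def nth_eq_iff_index_eq)
  finally show *: "card {j \<in> J. j < jth_smallest t J} = t - 1" .
  have "{j \<in> J. j \<le> jth_smallest t J} = insert (jth_smallest t J) {j \<in> J. j < jth_smallest t J}"
    using mem by auto
  then show "card {j \<in> J. j \<le> jth_smallest t J} = t" using * assms by simp
qed

lemma card_cells_in_rows:
  assumes "finite (shape T)" "finite I"
  shows "card {x \<in> shape T. T x = b \<and> fst x \<in> I} = (\<Sum>i\<in>I. row_count T i b)"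
proof -
  have "{x \<in> shape T. T x = b \<and> fst x \<in> I} = (SIGMA i:I. {j. (i, j) \<in> shape T \<and> T (i, j) = b})"
    by auto
  moreover have "finite {j. (i, j) \<in> shape T \<and> T (i, j) = b}" for i
    by (rule finite_subset[of _ "snd ` shape T"]) (force simp: assms)+
  ultimately show ?thesis using assms by (simp add: row_count_def)
qed

lemma card_row_entries:
  assumes "finite (shape T)" "finite B"
  shows "card {j. (i, j) \<in> shape T \<and> T (i, j) \<in> B} = (\<Sum>b\<in>B. row_count T i b)"
proof -
  have "{j. (i, j) \<in> shape T \<and> T (i, j) \<in> B} = (\<Union>b\<in>B. {j. (i, j) \<in> shape T \<and> T (i, j) = b})"
    by auto
  moreover have "finite {j. (i, j) \<in> shape T \<and> T (i, j) = b}" for b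
    by (rule finite_subset[of _ "snd ` shape T"]) (force simp: assms)+
  ultimately show ?thesis using assms by (simp add: row_count_def card_UN_disjoint disjoint_iff)
qed

lemma all_drop_iff_all_take_rev:
  fixes w :: "'a list"
  shows "(\<forall>n. count_list (drop n w) b \<le> count_list (drop n w) a) \<longleftrightarrow>
    (\<forall>n. count_list (take n (rev w)) b \<le> count_list (take n (rev w)) a)"
proof -
  have eq: "count_list (take n (rev w)) x = count_list (drop (length w - n) w) x" for n x
    by (simp add: take_rev)
  show ?thesis
  proof (intro iffI allI)
    fix n assume *: "\<forall>n. count_list (take n (rev w)) b \<le> count_list (take n (rev w)) a"
    show "count_list (drop n w) b \<le> count_list (drop n w) a"
    proof (cases "n \<le> length w")
      case True
      then show ?thesis using spec[OF *, of "length w - n"] by (simp add: eq)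
    qed simp
  qed (simp add: eq)
qed

section \<open>Semistandard tableaux and their row contents\<close>

text \<open>Row \<open>i\<close> of the shape occupies the columns \<open>L i + 1\<close> to \<open>R i\<close>.
  Skew diagrams and rotated diagrams both have this form. Since the ends of the rows move to the left from top to
  bottom, a cell and a second one weakly below and weakly to the right of it span a rectangle that lies in the
  shape.\<close>

locale skew_shape =
  fixes m :: nat and L R :: "nat \<Rightarrow> nat"
  assumes L_antimono: "1 \<le> i \<Longrightarrow> i \<le> i' \<Longrightarrow> i' \<le> m \<Longrightarrow> L i' \<le> L i"
    and R_antimono: "1 \<le> i \<Longrightarrow> i \<le> i' \<Longrightarrow> i' \<le> m \<Longrightarrow> R i' \<le> R i"
    and L_le_R: "1 \<le> i \<Longrightarrow> i \<le> m \<Longrightarrow> L i \<le> R i"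
begin

definition cells :: "(nat \<times> nat) set" where
  "cells = {(i, j). 1 \<le> i \<and> i \<le> m \<and> L i < j \<and> j \<le> R i}"

lemma mem_cells: "(i, j) \<in> cells \<longleftrightarrow> 1 \<le> i \<and> i \<le> m \<and> L i < j \<and> j \<le> R i"
  by (simp add: cells_def)

lemma finite_cells: "finite cells"
proof (rule finite_subset)
  show "cells \<subseteq> {1..m} \<times> {..R 1}" using R_antimono[of 1] by (force simp: cells_def)
qed simp

lemma corner_mem_cells:
  assumes "(i, j) \<in> cells" "(i', j') \<in> cells" "i \<le> i'" "j \<le> j'"
  shows "(i, j') \<in> cells" "(i', j) \<in> cells"
  using assms R_antimono[of i i'] L_antimono[of i i'] by (auto simp: mem_cells)

lemma SST_shape: "T \<in> SST cells \<Longrightarrow> shape T = cells"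
  by (simp add: SST_def)

lemma SST_outside: "T \<in> SST cells \<Longrightarrow> c \<notin> cells \<Longrightarrow> T c = 0"
  using SST_shape[of T] by (auto simp: shape_def)

lemma SST_row_mono: "T \<in> SST cells \<Longrightarrow> (i, j) \<in> cells \<Longrightarrow> (i, j') \<in> cells \<Longrightarrow> j \<le> j' \<Longrightarrow> T (i, j) \<le> T (i, j')"
  by (cases "j = j'") (auto simp: SST_def)

lemma SST_less:
  assumes "T \<in> SST cells" "(i, j) \<in> cells" "(i', j') \<in> cells" "i < i'" "j \<le> j'"
  shows "T (i, j) < T (i', j')"
proof -
  have "(i, j') \<in> cells" using assms corner_mem_cells(1)[of i j i' j'] by simp
  then have "T (i, j) \<le> T (i, j')" "T (i, j') < T (i', j')"
    using assms SST_row_mono[of T i j j'] by (auto simp: SST_def)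
  then show ?thesis by simp
qed

lemma SST_mono:
  assumes "T \<in> SST cells" "(i, j) \<in> cells" "(i', j') \<in> cells" "i \<le> i'" "j \<le> j'"
  shows "T (i, j) \<le> T (i', j')"
  using SST_less[OF assms(1-3)] SST_row_mono[OF assms(1)] assms
  by (cases "i = i'") (auto intro: less_imp_le)

lemma SST_equal_entries:
  assumes "T \<in> SST cells" "(i, j) \<in> cells" "(i', j') \<in> cells" "T (i, j) = T (i', j')" "i < i'"
  shows "j' < j"
  using SST_less[OF assms(1-3,5)] assms(4) by (cases "j \<le> j'") auto

lemma inj_on_snd_entries:
  assumes "T \<in> SST cells"
  shows "inj_on snd {x \<in> cells. T x = v}"
  using SST_equal_entries[OF assms] by (auto simp: inj_on_def) (metis less_irrefl linorder_neqE_nat)+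

lemma count_list_reading_word:
  assumes T: "T \<in> SST cells"
  shows "count_list (reading_word T) b = (\<Sum>i\<le>m. row_count T i b)"
proof -
  have "distinct (reading_cells T)"
    using sorted_wrt_reading_cells[of T]
    by (auto simp: distinct_conv_nth sorted_wrt_iff_nth_less precedes_def)
      (metis linorder_neqE_nat order_less_irrefl)
  then have "count_list (reading_word T) b = card {x \<in> shape T. T x = b}"
    by (simp add: reading_word_eq count_list_map_distinct set_reading_cells SST_shape[OF T] finite_cells)
  also have "{x \<in> shape T. T x = b} = {x \<in> shape T. T x = b \<and> fst x \<in> {..m}}"
    by (auto simp: SST_shape[OF T] mem_cells)
  also have "card \<dots> = (\<Sum>i\<le>m. row_count T i b)"
    by (rule card_cells_in_rows) (auto simp: SST_shape[OF T] finite_cells)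
  finally show ?thesis .
qed

text \<open>In a semistandard tableau equal entries move to the left from top to bottom, and no \<open>v\<close> lies
  weakly below and weakly to the right of a \<open>v + 1\<close>. If a \<open>v\<close> lies above and to the left
  of a \<open>v + 1\<close>, then the cell below the former in the row of the latter has an entry greater than
  \<open>v\<close> and at most \<open>v + 1\<close>. These are the hypotheses of
  \<open>column_prefix_iff_row_prefix\<close>.\<close>

lemma lattice_prefix_iff:
  assumes T: "T \<in> SST cells"
  shows "(\<forall>n. g + count_list (take n (reading_word T)) (Suc v) \<le> f + count_list (take n (reading_word T)) v) \<longleftrightarrow>
    (\<forall>i. g + (\<Sum>k\<le>i. row_count T k (Suc v)) \<le> f + (\<Sum>k<i. row_count T k v))"
proof -
  note sh = SST_shape[OF T]
  have set: "set (reading_cells T) = cells" using set_reading_cells[of T] sh finite_cells by simp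
  define X where "X = {x \<in> cells. T x = Suc v}"
  define Y where "Y = {x \<in> cells. T x = v}"
  have "(\<forall>n. g + count_list (take n (reading_word T)) (Suc v) \<le> f + count_list (take n (reading_word T)) v) \<longleftrightarrow>
      (\<forall>i. g + card {x \<in> X. int (fst x) \<le> i} \<le> f + card {y \<in> Y. int (fst y) < i})"
    unfolding reading_word_eq X_def Y_def set[symmetric]
  proof (rule column_prefix_iff_row_prefix[OF sorted_wrt_reading_cells], unfold set)
    show "v \<noteq> Suc v" by simp
    show "inj_on (\<lambda>x. int (snd x)) {x \<in> cells. T x = v}"
      using inj_on_snd_entries[OF T, of v] by (simp add: inj_on_def)
    fix x assume "x \<in> {x \<in> cells. T x = Suc v}"
    then obtain i j where x: "x = (i, j)" "(i, j) \<in> cells" "T (i, j) = Suc v" by (cases x) auto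
    show "int (snd x') < int (snd x)" if "x' \<in> {x \<in> cells. T x = Suc v}" "int (fst x) < int (fst x')" for x'
      using that x SST_equal_entries[OF T x(2), of "fst x'" "snd x'"] by auto
    fix y assume "y \<in> {x \<in> cells. T x = v}"
    then obtain i' j' where y: "y = (i', j')" "(i', j') \<in> cells" "T (i', j') = v" by (cases y) auto
    show "int (snd y) < int (snd x)" if "int (fst x) \<le> int (fst y)"
      using that x y SST_mono[OF T x(2) y(2)] by (force simp: not_le[symmetric])
    show "\<exists>x'\<in>{x \<in> cells. T x = Suc v}. int (fst x') = int (fst x) \<and> int (snd x') = int (snd y)"
      if "int (fst y) < int (fst x)" "int (snd y) < int (snd x)"
    proof -
      have c: "(i, j') \<in> cells" using corner_mem_cells(2)[OF y(2) x(2)] that x y by simp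
      moreover have "v < T (i, j')" using SST_less[OF T y(2) c] that x y by simp
      moreover have "T (i, j') \<le> Suc v" using SST_row_mono[OF T c x(2)] that x y by simp
      ultimately show ?thesis using x y by (intro bexI[of _ "(i, j')"]) auto
    qed
  qed
  also have "\<dots> \<longleftrightarrow> (\<forall>i. g + card {x \<in> X. fst x \<le> i} \<le> f + card {y \<in> Y. fst y < i})"
  proof (intro iffI allI)
    fix i :: nat
    assume "\<forall>i. g + card {x \<in> X. int (fst x) \<le> i} \<le> f + card {y \<in> Y. int (fst y) < i}"
    from spec[OF this, of "int i"]
    show "g + card {x \<in> X. fst x \<le> i} \<le> f + card {y \<in> Y. fst y < i}" by simp
  next
    fix i :: int
    assume *: "\<forall>i. g + card {x \<in> X. fst x \<le> i} \<le> f + card {y \<in> Y. fst y < i}"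
    show "g + card {x \<in> X. int (fst x) \<le> i} \<le> f + card {y \<in> Y. int (fst y) < i}"
    proof (cases "0 \<le> i")
      case True
      then have "int k \<le> i \<longleftrightarrow> k \<le> nat i" "int k < i \<longleftrightarrow> k < nat i" for k by linarith+
      then show ?thesis using spec[OF *, of "nat i"] by simp
    next
      case False
      then have "{x \<in> X. int (fst x) \<le> i} = {}" "{y \<in> Y. int (fst y) < i} = {}" by auto
      moreover have "g \<le> f" using spec[OF *, of 0] by simp
      ultimately show ?thesis by (simp only: card.empty)
    qed
  qed
  also have "\<dots> \<longleftrightarrow> (\<forall>i. g + (\<Sum>k\<le>i. row_count T k (Suc v)) \<le> f + (\<Sum>k<i. row_count T k v))"
    using card_cells_in_rows[of T "{.._}" "Suc v"] card_cells_in_rows[of T "{..<_}" v] finite_cells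
    by (simp add: sh X_def Y_def conj_ac)
  finally show ?thesis .
qed

text \<open>Suffixes are prefixes of the reversed word, which reads the columns from left to right and upwards; this
  is the reading order for negated coordinates. The \<open>v\<close> now plays the part of the entry to be bounded and
  \<open>v + 1\<close> that of the bounding entry.\<close>

lemma anti_lattice_suffix_iff:
  assumes T: "T \<in> SST cells"
  shows "(\<forall>n. count_list (drop n (reading_word T)) v \<le> count_list (drop n (reading_word T)) (Suc v)) \<longleftrightarrow>
    (\<forall>i. (\<Sum>k\<in>{i..m}. row_count T k v) \<le> (\<Sum>k\<in>{i<..m}. row_count T k (Suc v)))"
proof -
  note sh = SST_shape[OF T]
  have set: "set (rev (reading_cells T)) = cells" using set_reading_cells[of T] sh finite_cells by simp
  define X where "X = {x \<in> cells. T x = v}"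
  define Y where "Y = {x \<in> cells. T x = Suc v}"
  have sorted: "sorted_wrt (precedes (\<lambda>x. - int (fst x)) (\<lambda>x. - int (snd x))) (rev (reading_cells T))"
    unfolding sorted_wrt_rev
    by (rule sorted_wrt_mono_rel[OF _ sorted_wrt_reading_cells]) (auto simp: precedes_def)
  have "(\<forall>n. count_list (drop n (reading_word T)) v \<le> count_list (drop n (reading_word T)) (Suc v)) \<longleftrightarrow>
      (\<forall>n. 0 + count_list (take n (map T (rev (reading_cells T)))) v
          \<le> 0 + count_list (take n (map T (rev (reading_cells T)))) (Suc v))"
    by (simp add: all_drop_iff_all_take_rev reading_word_eq rev_map)
  also have "\<dots> \<longleftrightarrow>
      (\<forall>i. 0 + card {x \<in> X. - int (fst x) \<le> i} \<le> 0 + card {y \<in> Y. - int (fst y) < i})"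
    unfolding X_def Y_def set[symmetric]
  proof (rule column_prefix_iff_row_prefix[OF sorted], unfold set)
    show "Suc v \<noteq> v" by simp
    show "inj_on (\<lambda>x. - int (snd x)) {x \<in> cells. T x = Suc v}"
      using inj_on_snd_entries[OF T, of "Suc v"] by (simp add: inj_on_def)
    fix x assume "x \<in> {x \<in> cells. T x = v}"
    then obtain i j where x: "x = (i, j)" "(i, j) \<in> cells" "T (i, j) = v" by (cases x) auto
    show "- int (snd x') < - int (snd x)" if "x' \<in> {x \<in> cells. T x = v}" "- int (fst x) < - int (fst x')" for x'
      using that x SST_equal_entries[OF T _ x(2), of "fst x'" "snd x'"] by auto
    fix y assume "y \<in> {x \<in> cells. T x = Suc v}"
    then obtain i' j' where y: "y = (i', j')" "(i', j') \<in> cells" "T (i', j') = Suc v" by (cases y) auto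
    show "- int (snd y) < - int (snd x)" if "- int (fst x) \<le> - int (fst y)"
      using that x y SST_mono[OF T y(2) x(2)] by (force simp: not_le[symmetric])
    show "\<exists>x'\<in>{x \<in> cells. T x = v}. - int (fst x') = - int (fst x) \<and> - int (snd x') = - int (snd y)"
      if "- int (fst y) < - int (fst x)" "- int (snd y) < - int (snd x)"
    proof -
      have c: "(i, j') \<in> cells" using corner_mem_cells(1)[OF x(2) y(2)] that x y by simp
      moreover have "T (i, j') < Suc v" using SST_less[OF T c y(2)] that x y by simp
      moreover have "v \<le> T (i, j')" using SST_row_mono[OF T x(2) c] that x y by simp
      ultimately show ?thesis using x y by (intro bexI[of _ "(i, j')"]) auto
    qed
  qed
  also have "\<dots> \<longleftrightarrow> (\<forall>i. card {x \<in> X. i \<le> fst x} \<le> card {y \<in> Y. i < fst y})"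
  proof (intro iffI allI)
    fix i :: nat
    assume "\<forall>i. 0 + card {x \<in> X. - int (fst x) \<le> i} \<le> 0 + card {y \<in> Y. - int (fst y) < i}"
    from spec[OF this, of "- int i"]
    show "card {x \<in> X. i \<le> fst x} \<le> card {y \<in> Y. i < fst y}" by simp
  next
    fix i :: int
    assume *: "\<forall>i. card {x \<in> X. i \<le> fst x} \<le> card {y \<in> Y. i < fst y}"
    show "0 + card {x \<in> X. - int (fst x) \<le> i} \<le> 0 + card {y \<in> Y. - int (fst y) < i}"
    proof (cases "i \<le> 0")
      case True
      then have "- int k \<le> i \<longleftrightarrow> nat (- i) \<le> k" "- int k < i \<longleftrightarrow> nat (- i) < k" for k by linarith+
      then show ?thesis using spec[OF *, of "nat (- i)"] by simp
    next
      case False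
      have "card {x \<in> X. - int (fst x) \<le> i} \<le> card {x \<in> X. 0 \<le> fst x}"
        using finite_cells by (intro card_mono) (auto simp: X_def)
      also have "\<dots> \<le> card {y \<in> Y. 0 < fst y}" using spec[OF *, of 0] .
      also have "\<dots> \<le> card {y \<in> Y. - int (fst y) < i}"
        using finite_cells False by (intro card_mono) (auto simp: Y_def)
      finally show ?thesis by simp
    qed
  qed
  also have "\<dots> \<longleftrightarrow> (\<forall>i. (\<Sum>k\<in>{i..m}. row_count T k v) \<le> (\<Sum>k\<in>{i<..m}. row_count T k (Suc v)))"
  proof -
    have "{x \<in> X. i \<le> fst x} = {x \<in> shape T. T x = v \<and> fst x \<in> {i..m}}" for i
      by (auto simp: X_def sh mem_cells)
    moreover have "{x \<in> Y. i < fst x} = {x \<in> shape T. T x = Suc v \<and> fst x \<in> {i<..m}}" for i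
      by (auto simp: Y_def sh mem_cells)
    moreover have "finite (shape T)" using finite_cells sh by simp
    ultimately show ?thesis by (simp only: card_cells_in_rows finite_atLeastAtMost finite_greaterThanAtMost)
  qed
  finally show ?thesis .
qed

lemma entries_le_eq:
  assumes T: "T \<in> SST cells" and i: "1 \<le> i" "i \<le> m"
  shows "{j. (i, j) \<in> cells \<and> T (i, j) \<le> a} = {L i<..L i + (\<Sum>b\<le>a. row_count T i b)}"
proof -
  define J where "J = {j. (i, j) \<in> cells \<and> T (i, j) \<le> a}"
  have "J = {L i<..L i + card J}"
  proof (rule initial_segment_eq)
    show "finite J" by (rule finite_subset[of _ "{..R i}"]) (auto simp: J_def mem_cells)
    show "j' \<in> J" if "j \<in> J" "L i < j'" "j' \<le> j" for j j'
    proof -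
      have "(i, j') \<in> cells" using that by (auto simp: J_def mem_cells)
      then show ?thesis using that SST_row_mono[OF T, of i j' j] by (auto simp: J_def)
    qed
  qed (auto simp: J_def mem_cells)
  moreover have "card J = (\<Sum>b\<le>a. row_count T i b)"
    using card_row_entries[of T "{..a}" i] finite_cells by (simp add: J_def SST_shape[OF T])
  ultimately show ?thesis by (simp add: J_def)
qed

text \<open>The entries at most \<open>a\<close> form an initial segment of a row, so the row contents determine the
  tableau.\<close>

lemma entry_le_iff:
  assumes "T \<in> SST cells" "(i, j) \<in> cells"
  shows "T (i, j) \<le> a \<longleftrightarrow> j \<le> L i + (\<Sum>b\<le>a. row_count T i b)"
proof -
  have i: "1 \<le> i" "i \<le> m" "L i < j" using assms(2) by (auto simp: mem_cells)
  have "T (i, j) \<le> a \<longleftrightarrow> j \<in> {j. (i, j) \<in> cells \<and> T (i, j) \<le> a}" using assms(2) by simp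
  also have "\<dots> \<longleftrightarrow> j \<le> L i + (\<Sum>b\<le>a. row_count T i b)"
    unfolding entries_le_eq[OF assms(1) i(1,2)] using i by simp
  finally show ?thesis .
qed

text \<open>The row contents of tableaux with entries up to \<open>K\<close>. The last condition is column strictness:
  in row \<open>i + 1\<close>, the entries up to \<open>a + 1\<close> must not reach farther to the right than the
  entries up to \<open>a\<close> in row \<open>i\<close>.\<close>

definition contents :: "nat \<Rightarrow> (nat \<Rightarrow> nat \<Rightarrow> nat) set" where
  "contents K = {N. (\<forall>i a. N i a \<noteq> 0 \<longrightarrow> 1 \<le> i \<and> i \<le> m \<and> 1 \<le> a \<and> a \<le> K) \<and>
     (\<forall>i. 1 \<le> i \<and> i \<le> m \<longrightarrow> L i + (\<Sum>b\<le>K. N i b) = R i) \<and>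
     (\<forall>i a. 1 \<le> i \<and> i < m \<longrightarrow> L (Suc i) + (\<Sum>b\<le>Suc a. N (Suc i) b) \<le> L i + (\<Sum>b\<le>a. N i b))}"

lemma row_count_mem_contents:
  assumes T: "T \<in> SST cells" and bound: "\<forall>c. T c \<le> K"
  shows "row_count T \<in> contents K"
proof -
  note sh = SST_shape[OF T]
  have total: "L i + (\<Sum>b\<le>a. row_count T i b) \<le> R i" if i: "1 \<le> i" "i \<le> m" for i a
  proof -
    have "{L i<..L i + (\<Sum>b\<le>a. row_count T i b)} \<subseteq> {L i<..R i}"
      unfolding entries_le_eq[OF T i, symmetric] by (auto simp: mem_cells)
    then have "card {L i<..L i + (\<Sum>b\<le>a. row_count T i b)} \<le> card {L i<..R i}" by (intro card_mono) auto
    then show ?thesis using L_le_R[OF i] by simp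
  qed
  show ?thesis unfolding contents_def mem_Collect_eq
  proof (intro conjI allI impI)
    fix i a assume "row_count T i a \<noteq> 0"
    then obtain j where "(i, j) \<in> cells" "T (i, j) = a"
      by (metis (mono_tags, lifting) Collect_empty_eq card.empty row_count_def sh)
    moreover have "T (i, j) \<noteq> 0" using \<open>(i, j) \<in> cells\<close> sh by (auto simp: shape_def)
    ultimately show "1 \<le> i" "i \<le> m" "1 \<le> a" "a \<le> K" using bound by (auto simp: mem_cells Suc_le_eq)
  next
    fix i assume i: "1 \<le> i \<and> i \<le> m"
    have "{L i<..R i} \<subseteq> {L i<..L i + (\<Sum>b\<le>K. row_count T i b)}"
      using i bound by (subst entries_le_eq[OF T, symmetric]) (auto simp: mem_cells)
    then have "R i \<le> L i + (\<Sum>b\<le>K. row_count T i b)"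
      by (cases "L i < R i") (auto simp: subset_eq)
    then show "L i + (\<Sum>b\<le>K. row_count T i b) = R i" using total[of i K] i by simp
  next
    fix i a assume i: "1 \<le> i \<and> i < m"
    show "L (Suc i) + (\<Sum>b\<le>Suc a. row_count T (Suc i) b) \<le> L i + (\<Sum>b\<le>a. row_count T i b)"
    proof (rule ccontr)
      define j where "j = Suc (L i + (\<Sum>b\<le>a. row_count T i b))"
      assume "\<not> ?thesis"
      then have le: "j \<le> L (Suc i) + (\<Sum>b\<le>Suc a. row_count T (Suc i) b)" by (simp add: j_def)
      then have "j \<le> R (Suc i)" using total[of "Suc i" "Suc a"] i by simp
      then have c: "(i, j) \<in> cells" "(Suc i, j) \<in> cells"
        using i L_antimono[of i "Suc i"] R_antimono[of i "Suc i"] by (auto simp: mem_cells j_def)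
      then have "T (Suc i, j) \<le> Suc a" "T (i, j) < T (Suc i, j)"
        using le entry_le_iff[OF T c(2)] SST_less[OF T c] by auto
      then have "T (i, j) \<le> a" by simp
      then show False unfolding entry_le_iff[OF T c(1)] by (simp add: j_def)
    qed
  qed
qed

lemma inj_on_row_count: "inj_on row_count (SST cells)"
proof (rule inj_onI)
  fix T T' assume T: "T \<in> SST cells" "T' \<in> SST cells" "row_count T = row_count T'"
  show "T = T'"
  proof
    fix c
    show "T c = T' c"
    proof (cases "c \<in> cells")
      case True
      then obtain i j where c: "c = (i, j)" "(i, j) \<in> cells" by (cases c) auto
      have "T (i, j) \<le> a \<longleftrightarrow> T' (i, j) \<le> a" for a
        using entry_le_iff[OF T(1) c(2)] entry_le_iff[OF T(2) c(2)] T(3) by simp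
      then show ?thesis using c by (metis order_antisym order_refl)
    next
      case False
      then show ?thesis using SST_outside[OF T(1)] SST_outside[OF T(2)] by simp
    qed
  qed
qed

text \<open>\<open>entry_le_iff\<close> leaves no choice: the entry in column \<open>j\<close> is the least
  \<open>a\<close> such that the entries up to \<open>a\<close> extend to column \<open>j\<close>.\<close>

lemma ex_SST_with_contents:
  assumes N: "N \<in> contents K"
  shows "\<exists>T\<in>SST cells. (\<forall>c. T c \<le> K) \<and> row_count T = N"
proof -
  have N0: "N i a = 0" if "\<not> (1 \<le> i \<and> i \<le> m \<and> 1 \<le> a \<and> a \<le> K)" for i a
    using N that unfolding contents_def by blast
  have total: "L i + (\<Sum>b\<le>K. N i b) = R i" if "1 \<le> i" "i \<le> m" for i
    using N that unfolding contents_def by blast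
  have step: "L (Suc i) + (\<Sum>b\<le>Suc a. N (Suc i) b) \<le> L i + (\<Sum>b\<le>a. N i b)" if "1 \<le> i" "i < m" for i a
    using N that unfolding contents_def by blast
  define S where "S i a = L i + (\<Sum>b\<le>a. N i b)" for i a
  have S0: "S i 0 = L i" for i using N0[of i 0] by (simp add: S_def)
  have S_Suc: "S i (Suc a) = S i a + N i (Suc a)" for i a by (simp add: S_def)
  have S_mono: "a \<le> b \<Longrightarrow> S i a \<le> S i b" for i a b
    unfolding S_def by (intro add_left_mono sum_mono2) auto
  have S_K: "S i K = R i" if "1 \<le> i" "i \<le> m" for i using total[OF that] by (simp add: S_def)
  have S_le: "S i a \<le> R i" if "1 \<le> i" "i \<le> m" for i a
  proof -
    have "S i (K + d) = S i K" for d by (induction d) (auto simp: S_Suc N0)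
    then show ?thesis using S_mono[of a "K + a" i] S_K[OF that] by simp
  qed
  define T :: tableau where "T = (\<lambda>(i, j). if (i, j) \<in> cells then LEAST a. j \<le> S i a else 0)"
  have T_le: "T (i, j) \<le> a \<longleftrightarrow> j \<le> S i a" if c: "(i, j) \<in> cells" for i j a
  proof -
    have "j \<le> S i K" using c S_K[of i] by (simp add: mem_cells)
    then have "j \<le> S i (LEAST a. j \<le> S i a)" by (rule LeastI)
    then show ?thesis using c Least_le[of "\<lambda>a. j \<le> S i a" a] S_mono[of "LEAST a. j \<le> S i a" a i]
      by (auto simp: T_def)
  qed
  have T_pos: "T (i, j) \<noteq> 0" if "(i, j) \<in> cells" for i j
    using T_le[OF that, of 0] that by (simp add: S0 mem_cells)
  have sh: "shape T = cells"
    using T_pos by (auto simp: shape_def) (auto simp: T_def split: if_splits)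
  have bound: "T c \<le> K" for c
  proof (cases "c \<in> cells")
    case True
    then show ?thesis using T_le[of "fst c" "snd c" K] S_K[of "fst c"] by (cases c) (auto simp: mem_cells)
  next
    case False
    then show ?thesis by (cases c) (auto simp: T_def)
  qed
  have adj: "T (i, j) < T (Suc i, j)" if c: "(i, j) \<in> cells" "(Suc i, j) \<in> cells" for i j
  proof -
    obtain a where a: "T (Suc i, j) = Suc a" using T_pos[OF c(2)] by (cases "T (Suc i, j)") auto
    then have "j \<le> S (Suc i) (Suc a)" using T_le[OF c(2), of "Suc a"] by simp
    also have "\<dots> \<le> S i a" using step[of i a] c by (simp add: S_def mem_cells)
    finally show ?thesis using T_le[OF c(1), of a] a by simp
  qed
  have strict: "T (i, j) < T (i + Suc d, j)" if "(i, j) \<in> cells" "(i + Suc d, j) \<in> cells" for i j d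
    using that
  proof (induction d)
    case 0
    then show ?case using adj by simp
  next
    case (Suc d)
    have c: "(i + Suc d, j) \<in> cells"
      using Suc.prems R_antimono[of "i + Suc d" "i + Suc (Suc d)"] L_antimono[of i "i + Suc d"]
      by (auto simp: mem_cells)
    then show ?case using Suc adj[of "i + Suc d" j] by auto
  qed
  have "T \<in> SST cells"
    unfolding SST_def mem_Collect_eq
  proof (intro conjI allI impI)
    show "shape T = cells" by (rule sh)
    show "T (i, j) \<le> T (i, j')" if "(i, j) \<in> cells \<and> (i, j') \<in> cells \<and> j < j'" for i j j'
      using that T_le[of i j "T (i, j')"] T_le[of i j' "T (i, j')"] by simp
    show "T (i, j) < T (i', j)" if "(i, j) \<in> cells \<and> (i', j) \<in> cells \<and> i < i'" for i i' j
    proof -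
      have "i' = i + Suc (i' - i - 1)" using that by simp
      then show ?thesis using strict[of i j "i' - i - 1"] that by simp
    qed
  qed
  moreover have "row_count T i a = N i a" for i a
  proof (cases "1 \<le> i \<and> i \<le> m \<and> 1 \<le> a")
    case True
    then obtain a' where a': "a = Suc a'" by (cases a) auto
    have "{j. (i, j) \<in> shape T \<and> T (i, j) = a} = {S i a'<..S i a}"
    proof -
      have iff: "T (i, j) = a \<longleftrightarrow> S i a' < j \<and> j \<le> S i a" if "(i, j) \<in> cells" for j
        using T_le[OF that, of a] T_le[OF that, of a'] a' by auto
      have mem: "(i, j) \<in> cells" if "S i a' < j" "j \<le> S i a" for j
        using that True S_mono[of 0 a' i] S_le[of i a] by (auto simp: mem_cells S0)
      show ?thesis
      proof (rule set_eqI)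
        fix j
        show "j \<in> {j. (i, j) \<in> shape T \<and> T (i, j) = a} \<longleftrightarrow> j \<in> {S i a'<..S i a}"
          using iff[of j] mem[of j] by (auto simp only: sh mem_Collect_eq greaterThanAtMost_iff)
      qed
    qed
    then show ?thesis by (simp add: row_count_def a' S_Suc)
  next
    case False
    have "{j. (i, j) \<in> shape T \<and> T (i, j) = a} = {}"
    proof (rule ccontr)
      assume "\<not> ?thesis"
      then obtain j where c: "(i, j) \<in> cells" "T (i, j) = a" unfolding sh by blast
      show False using T_pos[OF c(1)] c False by (auto simp: mem_cells Suc_le_eq)
    qed
    then show ?thesis using N0[of i a] False by (simp only: row_count_def card.empty) auto
  qed
  then have "row_count T = N" by (intro ext)
  ultimately show ?thesis using bound by blast
qed

lemma bij_betw_row_count: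
  "bij_betw row_count {T \<in> SST cells. \<forall>c. T c \<le> K} (contents K)"
proof (rule bij_betw_imageI)
  show "inj_on row_count {T \<in> SST cells. \<forall>c. T c \<le> K}"
    by (rule inj_on_subset[OF inj_on_row_count]) auto
  show "row_count ` {T \<in> SST cells. \<forall>c. T c \<le> K} = contents K"
  proof
    show "row_count ` {T \<in> SST cells. \<forall>c. T c \<le> K} \<subseteq> contents K"
      using row_count_mem_contents by blast
    show "contents K \<subseteq> row_count ` {T \<in> SST cells. \<forall>c. T c \<le> K}"
    proof
      fix N assume "N \<in> contents K"
      then obtain T where "T \<in> SST cells" "\<forall>c. T c \<le> K" "N = row_count T"
        using ex_SST_with_contents by blast
      then show "N \<in> row_count ` {T \<in> SST cells. \<forall>c. T c \<le> K}" by blast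
    qed
  qed
qed

lemma entry_from_right:
  assumes T: "T \<in> SST cells" and bound: "\<forall>c. T c \<le> K"
    and t: "1 \<le> i" "i \<le> m" "1 \<le> t" "t \<le> R i - L i"
  shows "T (i, R i + 1 - t) = kth_largest K (row_count T i) t"
proof -
  define j0 where "j0 = R i + 1 - t"
  have c: "(i, j0) \<in> cells" unfolding mem_cells j0_def using t by linarith
  have cnt: "(\<Sum>b\<in>B. row_count T i b) = card {j. (i, j) \<in> cells \<and> T (i, j) \<in> B}" if "finite B" for B
    using card_row_entries[of T B i] that finite_cells by (simp add: SST_shape[OF T])
  have fin: "finite {j. (i, j) \<in> cells \<and> P j}" for P
    by (rule finite_subset[of _ "{..R i}"]) (auto simp: mem_cells)
  have "kth_largest K (row_count T i) t = T (i, j0)"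
  proof (rule kth_largest_eqI)
    have "{j. (i, j) \<in> cells \<and> T (i, j) \<in> {T (i, j0)<..K}} \<subseteq> {j0<..R i}"
      using SST_row_mono[OF T _ c] by (force simp: mem_cells not_le[symmetric])
    then have "card {j. (i, j) \<in> cells \<and> T (i, j) \<in> {T (i, j0)<..K}} \<le> card {j0<..R i}"
      by (intro card_mono) auto
    also have "\<dots> < t" using t by (simp add: j0_def)
    finally show "(\<Sum>b\<in>{T (i, j0)<..K}. row_count T i b) < t" by (simp add: cnt)
    have "{j0..R i} \<subseteq> {j. (i, j) \<in> cells \<and> T (i, j) \<in> {T (i, j0)..K}}"
      using SST_row_mono[OF T c] bound c by (auto simp: mem_cells)
    then have "card {j0..R i} \<le> card {j. (i, j) \<in> cells \<and> T (i, j) \<in> {T (i, j0)..K}}"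
      by (intro card_mono fin)
    moreover have "card {j0..R i} = t" using t by (simp add: j0_def)
    ultimately show "t \<le> (\<Sum>b\<in>{T (i, j0)..K}. row_count T i b)" by (simp only: cnt finite_atLeastAtMost)
  qed
  then show ?thesis by (simp add: j0_def)
qed

text \<open>Equal entries lie in distinct columns and move to the left from top to bottom. Hence the
  \<open>t\<close>-th leftmost entry \<open>e\<close> is also the \<open>t\<close>-th lowest one, where entries in the
  same row count from the left.\<close>

lemma row_of_leftmost_eq:
  assumes T: "T \<in> SST cells" and e: "1 \<le> e" and t: "1 \<le> t" "t \<le> (\<Sum>i\<le>m. row_count T i e)"
  shows "row_of_leftmost T t e = kth_largest m (\<lambda>i. row_count T i e) t"
proof -
  define C where "C = {x \<in> cells. T x = e}"
  define J where "J = {j. \<exists>i. T (i, j) = e}"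
  note off = SST_outside[OF T]
  have J: "J = snd ` C" using off e by (force simp: J_def C_def image_iff)
  have finC: "finite C" using finite_cells by (simp add: C_def)
  have cnt: "(\<Sum>i\<in>I. row_count T i e) = card {x \<in> C. fst x \<in> I}" if "finite I" for I
    using card_cells_in_rows[of T I e] that finite_cells by (simp add: SST_shape[OF T] C_def conj_ac)
  have "{x \<in> C. fst x \<in> {..m}} = C" by (auto simp: C_def mem_cells)
  then have "card J = (\<Sum>i\<le>m. row_count T i e)"
    unfolding J C_def using inj_on_snd_entries[OF T, of e] cnt[of "{..m}"] by (simp add: card_image C_def)
  then have t': "t \<le> card J" "finite J" using t J finC by auto
  define j where "j = jth_smallest t J"
  note jp = jth_smallest_props[OF t'(2) t(1) t'(1), folded j_def]
  obtain a where a: "(a, j) \<in> C" using jp(1) J by auto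
  have ac: "(a, j) \<in> cells" "T (a, j) = e" using a by (auto simp: C_def)
  have "row_of_leftmost T t e = a"
    unfolding row_of_leftmost_def J_def[symmetric] j_def[symmetric]
  proof (rule the_equality)
    fix i assume i: "T (i, j) = e"
    then have "(i, j) \<in> cells" using off e by force
    then show "i = a" using SST_less[OF T _ ac(1), of i j] SST_less[OF T ac(1), of i j] i ac(2)
      by (cases i a rule: linorder_cases) auto
  qed (use ac in auto)
  moreover have "kth_largest m (\<lambda>i. row_count T i e) t = a"
  proof (rule kth_largest_eqI)
    have inj: "inj_on snd D" if "D \<subseteq> C" for D
      using inj_on_subset[OF inj_on_snd_entries[OF T, of e]] that by (simp add: C_def)
    have "snd ` {x \<in> C. fst x \<in> {a<..m}} \<subseteq> {j' \<in> J. j' < j}"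
    proof
      fix j' assume "j' \<in> snd ` {x \<in> C. fst x \<in> {a<..m}}"
      then obtain i where i: "(i, j') \<in> C" "a < i" by auto
      then have "j' < j" using SST_equal_entries[OF T ac(1), of i j'] ac by (auto simp: C_def)
      then show "j' \<in> {j' \<in> J. j' < j}" using i J by force
    qed
    then have "card (snd ` {x \<in> C. fst x \<in> {a<..m}}) \<le> t - 1"
      unfolding jp(2)[symmetric] using t' by (intro card_mono) auto
    then show "(\<Sum>i\<in>{a<..m}. row_count T i e) < t"
      using t by (subst (asm) card_image[OF inj]) (auto simp: cnt)
    have "{j' \<in> J. j' \<le> j} \<subseteq> snd ` {x \<in> C. fst x \<in> {a..m}}"
    proof
      fix j' assume "j' \<in> {j' \<in> J. j' \<le> j}"
      then obtain i where i: "(i, j') \<in> C" "j' \<le> j" using J by auto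
      then have ic: "(i, j') \<in> cells" "T (i, j') = e" by (auto simp: C_def)
      then have "\<not> i < a" using SST_less[OF T ic(1) ac(1)] ac i by auto
      then show "j' \<in> snd ` {x \<in> C. fst x \<in> {a..m}}"
        using i ic by (intro image_eqI[of _ _ "(i, j')"]) (auto simp: mem_cells)
    qed
    then have "t \<le> card (snd ` {x \<in> C. fst x \<in> {a..m}})"
      using jp(3) finC card_mono[of "snd ` {x \<in> C. fst x \<in> {a..m}}" "{j' \<in> J. j' \<le> j}"] by simp
    then show "t \<le> (\<Sum>i\<in>{a..m}. row_count T i e)"
      by (subst (asm) card_image[OF inj]) (auto simp: cnt)
  qed
  ultimately show ?thesis by simp
qed

end

section \<open>Comparison of the two sets of tableaux\<close>

text \<open>The prefix condition for insertion is a ballot condition with the parts of \<open>delta\<close> as initial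
  values, and therefore a condition on rows.\<close>

lemma (in skew_shape) insert_tableau_H_iff:
  assumes T: "T \<in> SST cells" and lam: "is_partition lam" and delta: "is_partition delta"
  shows "insert_tableau T (columns (H_tableau delta)) = columns (H_tableau lam) \<longleftrightarrow>
    (\<forall>a\<ge>1. \<forall>i. part delta (Suc a) + (\<Sum>k\<le>i. row_count T k (Suc a))
              \<le> part delta a + (\<Sum>k<i. row_count T k a)) \<and>
    (\<forall>a\<ge>1. part delta a + (\<Sum>k\<le>m. row_count T k a) = part lam a)"
proof -
  have "set (reading_word T) = T ` shape T"
    using finite_cells by (simp add: reading_word_eq set_reading_cells SST_shape[OF T])
  then have pos: "\<forall>a\<in>set (reading_word T). 1 \<le> a" by (auto simp: shape_def Suc_le_eq)
  have "insert_tableau T (columns (H_tableau delta)) = columns (H_tableau lam) \<longleftrightarrow>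
    (\<forall>n. \<forall>a\<ge>1. row_length (column_lengths delta) (Suc a) + count_list (take n (reading_word T)) (Suc a)
                \<le> row_length (column_lengths delta) a + count_list (take n (reading_word T)) a) \<and>
    (\<forall>a\<ge>1. row_length (column_lengths delta) a + count_list (reading_word T) a
        = row_length (column_lengths lam) a)"
    unfolding insert_tableau_def columns_H_tableau[OF lam] columns_H_tableau[OF delta]
    by (rule fold_column_insert_initial_iff[OF column_lengths_sorted column_lengths_pos[OF delta]
        column_lengths_sorted column_lengths_pos[OF lam] pos])
  also have "\<dots> \<longleftrightarrow>
    (\<forall>a\<ge>1. \<forall>n. part delta (Suc a) + count_list (take n (reading_word T)) (Suc a)
                \<le> part delta a + count_list (take n (reading_word T)) a) \<and>
    (\<forall>a\<ge>1. part delta a + count_list (reading_word T) a = part lam a)"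
    using row_length_column_lengths[OF delta] row_length_column_lengths[OF lam] by auto
  finally show ?thesis unfolding lattice_prefix_iff[OF T] count_list_reading_word[OF T] .
qed

text \<open>The entries of a column that starts in row 1 are positive and strictly increasing.\<close>

lemma SST_entry_ge_row:
  assumes "T \<in> SST D" "\<And>i'. 1 \<le> i' \<Longrightarrow> i' \<le> i \<Longrightarrow> (i', j) \<in> D" "1 \<le> i"
  shows "i \<le> T (i, j)"
  using assms(3,2)
proof (induction i rule: dec_induct)
  case base
  then show ?case using assms(1) by (auto simp: SST_def shape_def Suc_le_eq)
next
  case (step i)
  then have "T (i, j) < T (Suc i, j)" using assms(1) by (auto simp: SST_def)
  then show ?case using step by fastforce
qed

lemma n_seq_cong:
  "(\<And>i. j < i \<Longrightarrow> i \<le> p \<Longrightarrow> m i = m' i) \<Longrightarrow> n_seq n p m j = n_seq n p m' j"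
  unfolding n_seq_def by (metis (no_types, lifting) Suc_eq_plus1 Suc_le_eq atLeastAtMost_iff image_cong)

lemma rotated_diagram_eq:
  assumes "is_partition mu"
  shows "rotated_diagram mu = {(i, j). 1 \<le> i \<and> i \<le> length mu \<and>
    part mu 1 - part mu (length mu + 1 - i) < j \<and> j \<le> part mu 1}" (is "_ = ?D")
proof (intro set_eqI iffI)
  fix x assume "x \<in> rotated_diagram mu"
  then obtain i j where ij: "(i, j) \<in> diagram mu" "x = (length mu + 1 - i, part mu 1 + 1 - j)"
    by (auto simp: rotated_diagram_def)
  have "1 \<le> i" "i \<le> length mu" "1 \<le> j" "j \<le> part mu i" using ij by (auto simp: diagram_def)
  moreover have "part mu i \<le> part mu 1" using part_antimono[OF assms, of 1 i] calculation by simp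
  ultimately show "x \<in> ?D" using ij(2) by auto
next
  fix x assume "x \<in> ?D"
  then obtain i j where x: "x = (i, j)" "1 \<le> i" "i \<le> length mu"
    "part mu 1 - part mu (length mu + 1 - i) < j" "j \<le> part mu 1" by auto
  then have "(length mu + 1 - i, part mu 1 + 1 - j) \<in> diagram mu" by (auto simp: diagram_def)
  moreover have "x = (length mu + 1 - (length mu + 1 - i), part mu 1 + 1 - (part mu 1 + 1 - j))"
    using x by auto
  ultimately show "x \<in> rotated_diagram mu" by (force simp: rotated_diagram_def)
qed

lemma part_pos: "is_partition mu \<Longrightarrow> 1 \<le> i \<Longrightarrow> i \<le> length mu \<Longrightarrow> 1 \<le> part mu i"
proof -
  assume *: "is_partition mu" "1 \<le> i" "i \<le> length mu"
  then have "mu ! (i - 1) \<in> set mu" by (intro nth_mem) simp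
  then have "mu ! (i - 1) \<noteq> 0" using * by (metis is_partition_def)
  then show ?thesis using * by (simp add: Defs.part_def Suc_le_eq)
qed

lemma conj_part_1:
  assumes "is_partition mu" shows "conj_part mu 1 = length mu"
proof -
  have "{i \<in> {1..length mu}. 1 \<le> part mu i} = {1..length mu}" using part_pos[OF assms] by auto
  then show ?thesis by (simp add: conj_part_def)
qed

lemma bij_betw_filter:
  assumes "bij_betw f A B" "\<And>x. x \<in> A \<Longrightarrow> P x \<longleftrightarrow> Q (f x)"
  shows "bij_betw f {x \<in> A. P x} {y \<in> B. Q y}"
  using assms by (auto simp: bij_betw_def inj_on_def image_iff)

text \<open>Row \<open>i\<close> of the rotated diagram occupies the columns \<open>left_end mu i + 1\<close> to
  \<open>right_end mu i\<close>, as required for \<open>skew_shape\<close>.\<close>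

definition left_end :: "nat list \<Rightarrow> nat \<Rightarrow> nat" where
  "left_end mu i = part mu 1 - part mu (length mu + 1 - i)"

definition right_end :: "nat list \<Rightarrow> nat \<Rightarrow> nat" where
  "right_end mu i = part mu 1"

lemma skew_shape_rotated:
  assumes "is_partition mu"
  shows "skew_shape (length mu) (left_end mu) (right_end mu)"
proof
  fix i i' assume "1 \<le> i" "i \<le> i'" "i' \<le> length mu"
  then have "part mu (length mu + 1 - i) \<le> part mu (length mu + 1 - i')"
    by (intro part_antimono[OF assms]) auto
  then show "left_end mu i' \<le> left_end mu i" by (simp add: left_end_def)
qed (auto simp: left_end_def right_end_def)

lemma skew_shape_parts:
  assumes "is_partition lam" "is_partition delta" "\<And>a. part delta a \<le> part lam a"
  shows "skew_shape (length lam) (part delta) (part lam)"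
  using part_antimono assms by unfold_locales auto

lemma diagram_subset_iff: "diagram delta \<subseteq> diagram lam \<longleftrightarrow> (\<forall>a. part delta a \<le> part lam a)"
proof
  assume *: "diagram delta \<subseteq> diagram lam"
  show "\<forall>a. part delta a \<le> part lam a"
  proof
    fix a
    show "part delta a \<le> part lam a"
    proof (cases "1 \<le> a \<and> 1 \<le> part delta a")
      case True
      then have "(a, part delta a) \<in> diagram delta" by (simp add: mem_diagram_iff)
      then have "(a, part delta a) \<in> diagram lam" using * by blast
      then show ?thesis by (simp add: mem_diagram_iff)
    next
      case False
      then have "part delta a = 0" by (cases "a = 0", simp add: Defs.part_def, simp)
      then show ?thesis by simp
    qed
  qed
next
  assume le: "\<forall>a. part delta a \<le> part lam a"
  show "diagram delta \<subseteq> diagram lam"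
  proof
    fix c assume "c \<in> diagram delta"
    then show "c \<in> diagram lam" using spec[OF le, of "fst c"] by (cases c) (auto simp: mem_diagram_iff)
  qed
qed

context
  fixes lam delta mu :: "nat list" and p h :: nat
  assumes mu: "is_partition mu" and lam: "is_partition lam" and delta: "is_partition delta"
    and sub: "\<And>a. part delta a \<le> part lam a"
  defines "p \<equiv> length mu" and "h \<equiv> length lam"
begin

lemma part_mu_pos: "1 \<le> i \<Longrightarrow> i \<le> p \<Longrightarrow> 1 \<le> part mu i"
  unfolding p_def by (rule part_pos[OF mu])

lemma part_mu_le: "1 \<le> i \<Longrightarrow> part mu i \<le> part mu 1"
  by (rule part_antimono[OF mu]) auto

lemma part_lam_eq_0: "h < a \<Longrightarrow> part lam a = 0"
  by (simp add: Defs.part_def h_def)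

lemma left_end_eq: "left_end mu i = part mu 1 - part mu (p + 1 - i)"
  by (simp add: left_end_def p_def)

interpretation V: skew_shape p "left_end mu" "right_end mu"
  unfolding p_def by (rule skew_shape_rotated[OF mu])

interpretation U: skew_shape h "part delta" "part lam"
  unfolding h_def by (rule skew_shape_parts[OF lam delta sub])

text \<open>Here \<open>N k a\<close> is the number of entries \<open>a\<close> in row \<open>k\<close> of a tableau
  \<open>V\<close> of rotated shape, and at the same time the number of entries \<open>k\<close> in row
  \<open>a\<close> of a tableau \<open>U\<close> of shape \<open>lam / delta\<close>. The conditions on
  \<open>V\<close> and on \<open>U\<close> are the same four families of relations with exchanged meaning: the row
  lengths of \<open>V\<close> are the content of \<open>U\<close>, the column strictness of \<open>V\<close> is the
  anti-lattice property of \<open>U\<close>, the condition that insertion stays among the highest weight tableaux is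
  the column strictness of \<open>U\<close>, and the condition that it ends with \<open>lam\<close> prescribes the row
  lengths of \<open>U\<close>.\<close>

lemma contents_transpose_iff:
  fixes N :: "nat \<Rightarrow> nat \<Rightarrow> nat"
  shows "N \<in> V.contents h \<and>
      (\<forall>a\<ge>1. \<forall>i. part delta (Suc a) + (\<Sum>k\<le>i. N k (Suc a)) \<le> part delta a + (\<Sum>k<i. N k a)) \<and>
      (\<forall>a\<ge>1. part delta a + (\<Sum>k\<le>p. N k a) = part lam a) \<longleftrightarrow>
    (\<lambda>a k. N k a) \<in> U.contents p \<and>
      (\<forall>k\<in>{1..p}. (\<Sum>a\<le>h. N k a) = part mu (p + 1 - k)) \<and>
      (\<forall>k. 1 \<le> k \<and> k < p \<longrightarrow> (\<forall>i. (\<Sum>a\<in>{i..h}. N k a) \<le> (\<Sum>a\<in>{i<..h}. N (Suc k) a)))"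
proof -
  define Supp where "Supp \<longleftrightarrow> (\<forall>k a. N k a \<noteq> 0 \<longrightarrow> 1 \<le> k \<and> k \<le> p \<and> 1 \<le> a \<and> a \<le> h)"
  define VRows where "VRows \<longleftrightarrow> (\<forall>k. 1 \<le> k \<and> k \<le> p \<longrightarrow>
    left_end mu k + (\<Sum>b\<le>h. N k b) = right_end mu k)"
  define VCols where "VCols \<longleftrightarrow> (\<forall>k a. 1 \<le> k \<and> k < p \<longrightarrow>
    left_end mu (Suc k) + (\<Sum>b\<le>Suc a. N (Suc k) b) \<le> left_end mu k + (\<Sum>b\<le>a. N k b))"
  define Lattice where "Lattice \<longleftrightarrow> (\<forall>a\<ge>1. \<forall>i. part delta (Suc a) + (\<Sum>k\<le>i. N k (Suc a))
    \<le> part delta a + (\<Sum>k<i. N k a))"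
  define Target where "Target \<longleftrightarrow> (\<forall>a\<ge>1. part delta a + (\<Sum>k\<le>p. N k a) = part lam a)"
  define URows where "URows \<longleftrightarrow> (\<forall>a. 1 \<le> a \<and> a \<le> h \<longrightarrow> part delta a + (\<Sum>k\<le>p. N k a) = part lam a)"
  define UCols where "UCols \<longleftrightarrow> (\<forall>a k. 1 \<le> a \<and> a < h \<longrightarrow>
    part delta (Suc a) + (\<Sum>b\<le>Suc k. N b (Suc a)) \<le> part delta a + (\<Sum>b\<le>k. N b a))"
  define Content where "Content \<longleftrightarrow> (\<forall>k\<in>{1..p}. (\<Sum>a\<le>h. N k a) = part mu (p + 1 - k))"
  define Anti where "Anti \<longleftrightarrow> (\<forall>k. 1 \<le> k \<and> k < p \<longrightarrow>
    (\<forall>i. (\<Sum>a\<in>{i..h}. N k a) \<le> (\<Sum>a\<in>{i<..h}. N (Suc k) a)))"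
  have mu_le: "part mu (p + 1 - k) \<le> part mu 1" if "1 \<le> k" "k \<le> p" for k
    using that by (intro part_antimono[OF mu]) auto
  have "VRows \<longleftrightarrow> Content"
    using mu_le by (fastforce simp: VRows_def Content_def left_end_eq right_end_def)
  moreover have "Target \<longleftrightarrow> URows" if Supp
  proof -
    have "part delta a + (\<Sum>k\<le>p. N k a) = part lam a" if "h < a" for a
    proof -
      have "part lam a = 0" using that by (rule part_lam_eq_0)
      moreover have "N k a = 0" for k using \<open>Supp\<close> that unfolding Supp_def by (metis not_le)
      ultimately show ?thesis using sub[of a] by simp
    qed
    then show ?thesis unfolding Target_def URows_def by (metis not_le)
  qed
  moreover have "Lattice \<longleftrightarrow> UCols" if Supp
  proof
    assume L: Lattice
    show UCols unfolding UCols_def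
    proof (intro allI impI)
      fix a k assume "1 \<le> a \<and> a < h"
      then show "part delta (Suc a) + (\<Sum>b\<le>Suc k. N b (Suc a)) \<le> part delta a + (\<Sum>b\<le>k. N b a)"
        using L[unfolded Lattice_def, rule_format, of a "Suc k"] by (simp only: lessThan_Suc_atMost)
    qed
  next
    assume UC: UCols
    show Lattice unfolding Lattice_def
    proof (intro allI impI)
      fix a i :: nat assume a: "1 \<le> a"
      have d: "part delta (Suc a) \<le> part delta a" using part_antimono[OF delta a, of "Suc a"] by simp
      show "part delta (Suc a) + (\<Sum>k\<le>i. N k (Suc a)) \<le> part delta a + (\<Sum>k<i. N k a)"
      proof (cases "a < h")
        case True
        have "N 0 (Suc a) = 0" using \<open>Supp\<close> unfolding Supp_def by (metis not_one_le_zero)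
        then show ?thesis using UC[unfolded UCols_def, rule_format, of a "i - 1"] a True d
          by (cases i) (simp_all only: lessThan_Suc_atMost diff_Suc_1, simp_all)
      next
        case False
        then have "part lam (Suc a) = 0" by (intro part_lam_eq_0) simp
        moreover have "N k (Suc a) = 0" for k using \<open>Supp\<close> False unfolding Supp_def by (metis Suc_leD Suc_le_eq)
        ultimately show ?thesis using sub[of "Suc a"] by simp
      qed
    qed
  qed
  moreover have "VCols \<longleftrightarrow> Anti" if Supp VRows
  proof -
    \<comment> \<open>The rows of a rotated diagram are aligned at their right ends, so column strictness is
      expressed by the numbers of large entries instead of small ones.\<close>
    have split: "(\<Sum>b\<le>a. N k b) + (\<Sum>b\<in>{a<..h}. N k b) = (\<Sum>b\<le>h. N k b)" for k a
    proof -
      have "(\<Sum>b\<le>a. N k b) + (\<Sum>b\<in>{a<..h}. N k b) = (\<Sum>b\<in>{..a} \<union> {a<..h}. N k b)"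
        by (intro sum.union_disjoint[symmetric]) auto
      also have "\<dots> = (\<Sum>b\<le>h. N k b)"
      proof (rule sum.mono_neutral_right)
        show "\<forall>b\<in>{..a} \<union> {a<..h} - {..h}. N k b = 0" using \<open>Supp\<close> unfolding Supp_def by fastforce
      qed auto
      finally show ?thesis .
    qed
    have "left_end mu (Suc k) + (\<Sum>b\<le>Suc a. N (Suc k) b) \<le> left_end mu k + (\<Sum>b\<le>a. N k b) \<longleftrightarrow>
      (\<Sum>b\<in>{a<..h}. N k b) \<le> (\<Sum>b\<in>{Suc a<..h}. N (Suc k) b)" if k: "1 \<le> k" "k < p" for k a
      using \<open>VRows\<close>[unfolded VRows_def, rule_format, of k] \<open>VRows\<close>[unfolded VRows_def, rule_format, of "Suc k"]
        split[where k = k and a = a] split[where k = "Suc k" and a = "Suc a"] k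
      unfolding right_end_def by linarith
    then have "VCols \<longleftrightarrow> (\<forall>k. 1 \<le> k \<and> k < p \<longrightarrow>
        (\<forall>a. (\<Sum>b\<in>{a<..h}. N k b) \<le> (\<Sum>b\<in>{Suc a<..h}. N (Suc k) b)))"
      unfolding VCols_def by blast
    also have "\<dots> \<longleftrightarrow> Anti"
    proof -
      have "(\<forall>a. (\<Sum>b\<in>{a<..h}. N k b) \<le> (\<Sum>b\<in>{Suc a<..h}. N (Suc k) b)) \<longleftrightarrow>
          (\<forall>i. (\<Sum>a\<in>{i..h}. N k a) \<le> (\<Sum>a\<in>{i<..h}. N (Suc k) a))" (is "?A \<longleftrightarrow> ?B") for k
      proof
        assume A: ?A
        show ?B
        proof
          fix i
          show "(\<Sum>a\<in>{i..h}. N k a) \<le> (\<Sum>a\<in>{i<..h}. N (Suc k) a)"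
          proof (cases i)
            case 0
            have "N k 0 = 0" using \<open>Supp\<close> unfolding Supp_def by (metis not_one_le_zero)
            then have "(\<Sum>a\<in>{0..h}. N k a) = (\<Sum>a\<in>{0<..h}. N k a)"
              by (intro sum.mono_neutral_right) (auto simp: not_less)
            also have "\<dots> \<le> (\<Sum>a\<in>{Suc 0<..h}. N (Suc k) a)" using A by blast
            also have "\<dots> \<le> (\<Sum>a\<in>{0<..h}. N (Suc k) a)" by (intro sum_mono2) auto
            finally show ?thesis using 0 by simp
          next
            case (Suc a)
            then show ?thesis using A by (simp add: atLeastSucAtMost_greaterThanAtMost)
          qed
        qed
      next
        assume B: ?B
        show ?A
        proof
          fix a
          show "(\<Sum>b\<in>{a<..h}. N k b) \<le> (\<Sum>b\<in>{Suc a<..h}. N (Suc k) b)"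
            using spec[OF B, of "Suc a"] by (simp add: atLeastSucAtMost_greaterThanAtMost)
        qed
      qed
      then show ?thesis unfolding Anti_def by blast
    qed
    finally show ?thesis .
  qed
  moreover have "N \<in> V.contents h \<longleftrightarrow> Supp \<and> VRows \<and> VCols"
    unfolding V.contents_def mem_Collect_eq Supp_def VRows_def VCols_def ..
  moreover have "(\<lambda>a k. N k a) \<in> U.contents p \<longleftrightarrow> Supp \<and> URows \<and> UCols"
    unfolding U.contents_def mem_Collect_eq Supp_def URows_def UCols_def by blast
  ultimately show ?thesis
    unfolding Lattice_def[symmetric] Target_def[symmetric] Content_def[symmetric] Anti_def[symmetric] by blast
qed

text \<open>The inequalities on \<open>\<sigma>\<close> and \<open>\<tau>\<close>, expressed by the common contents
  matrix \<open>N\<close>: the \<open>t\<close>-th entry from the right in row \<open>k\<close> of \<open>V\<close>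
  and the row of the \<open>t\<close>-th leftmost \<open>k\<close> in \<open>U\<close> both are the
  \<open>t\<close>-th largest element of row \<open>k\<close> of \<open>N\<close>.\<close>

definition selected :: "nat \<Rightarrow> (nat \<Rightarrow> nat \<Rightarrow> nat) \<Rightarrow> bool" where
  "selected n N \<longleftrightarrow> (\<forall>j\<in>{1..conj_part mu 2}. kth_largest h (N (p + 1 - j)) 2 +
     n_seq n p (\<lambda>i. min (n + 1 - kth_largest h (N (p + 1 - i)) 1) (2 * i - 1)) j \<le> n + 1)"

lemma cells_V: "rotated_diagram mu = V.cells"
  unfolding V.cells_def unfolding rotated_diagram_eq[OF mu] p_def left_end_def right_end_def ..

lemma cells_U: "diagram lam - diagram delta = U.cells"
proof (rule set_eqI)
  fix c :: "nat \<times> nat"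
  obtain i j where c: "c = (i, j)" by (cases c)
  have "i \<le> h" if "1 \<le> j" "j \<le> part lam i" using part_lam_eq_0[of i] that by (cases "h < i") auto
  then show "c \<in> diagram lam - diagram delta \<longleftrightarrow> c \<in> U.cells"
    by (auto simp: c U.mem_cells mem_diagram_iff)
qed

lemma q_le_p: "conj_part mu 2 \<le> p"
proof -
  have "conj_part mu 2 \<le> card {1..length mu}" unfolding conj_part_def by (intro card_mono) auto
  then show ?thesis by (simp add: p_def)
qed

lemma two_le_part: "1 \<le> j \<Longrightarrow> j \<le> conj_part mu 2 \<Longrightarrow> 2 \<le> part mu j"
  using le_part_iff_le_conj_part[OF mu, of j 2] by simp

text \<open>The two definitions of \<open>m\<close> differ at an index \<open>i > r\<close> at most, where
  \<open>r = n - p\<close>. The entry \<open>\<sigma> i\<close> of the last column lies in row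
  \<open>p + 1 - i\<close>, so it is at least \<open>p + 1 - i\<close>. Thus
  \<open>n + 1 - \<sigma> i \<le> n - p + i \<le> 2 * i - 1\<close>, and both definitions give
  \<open>n + 1 - \<sigma> i\<close>.\<close>

lemma V_selected_iff:
  assumes V: "V \<in> SST V.cells" and bound: "\<forall>c. V c \<le> h" and "p \<le> n"
  shows "(let p = conj_part mu 1;
          q = conj_part mu 2;
          r = (if 2 * p \<le> n then p else n - p);
          \<sigma> = (\<lambda>i. V (p + 1 - i, part mu 1));
          \<tau> = (\<lambda>j. V (p + 1 - j, part mu 1 - 1));
          m = (\<lambda>i. if i \<le> r then min (n + 1 - \<sigma> i) (2 * i - 1)
                   else min (n + 1 - \<sigma> i) (n - p + i))
      in \<forall>j\<in>{1..q}. \<tau> j + n_seq n p m j \<le> n + 1) \<longleftrightarrow> selected n (row_count V)"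
proof -
  have conj1: "conj_part mu 1 = p" using conj_part_1[OF mu] by (simp add: p_def)
  have sigma: "V (p + 1 - i, part mu 1) = kth_largest h (row_count V (p + 1 - i)) 1"
    if "1 \<le> i" "i \<le> p" for i
    using V.entry_from_right[OF V bound, of "p + 1 - i" 1] that part_mu_pos[of i] part_mu_le[of i]
    by (simp add: left_end_eq right_end_def)
  have tau: "V (p + 1 - j, part mu 1 - 1) = kth_largest h (row_count V (p + 1 - j)) 2"
    if "1 \<le> j" "j \<le> conj_part mu 2" for j
    using V.entry_from_right[OF V bound, of "p + 1 - j" 2] that two_le_part[OF that] q_le_p part_mu_le[of j]
    by (simp add: left_end_eq right_end_def numeral_2_eq_2)
  have sigma_ge: "p + 1 - i \<le> V (p + 1 - i, part mu 1)" if "1 \<le> i" "i \<le> p" for i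
  proof (rule SST_entry_ge_row[OF V])
    show "(i', part mu 1) \<in> V.cells" if "1 \<le> i'" "i' \<le> p + 1 - i" for i'
    proof -
      have "1 \<le> p + 1 - i'" "p + 1 - i' \<le> p" using that \<open>1 \<le> i\<close> \<open>i \<le> p\<close> by linarith+
      then have "1 \<le> part mu (p + 1 - i')" "part mu (p + 1 - i') \<le> part mu 1"
        using part_mu_pos part_mu_le by blast+
      then show ?thesis using that \<open>p + 1 - i' \<le> p\<close> \<open>1 \<le> p + 1 - i'\<close>
        unfolding V.mem_cells left_end_eq right_end_def by linarith
    qed
  qed (use that in simp)
  define m where "m = (\<lambda>i. if i \<le> (if 2 * p \<le> n then p else n - p)
      then min (n + 1 - V (p + 1 - i, part mu 1)) (2 * i - 1)
      else min (n + 1 - V (p + 1 - i, part mu 1)) (n - p + i))"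
  have m: "m i = min (n + 1 - kth_largest h (row_count V (p + 1 - i)) 1) (2 * i - 1)"
    if "1 \<le> i" "i \<le> p" for i
  proof -
    define s where "s = kth_largest h (row_count V (p + 1 - i)) 1"
    have s: "p + 1 - i \<le> s" using sigma_ge[OF that] sigma[OF that] by (simp add: s_def)
    have m_eq: "m i = (if i \<le> (if 2 * p \<le> n then p else n - p) then min (n + 1 - s) (2 * i - 1)
        else min (n + 1 - s) (n - p + i))"
      unfolding m_def sigma[OF that] s_def ..
    show ?thesis
    proof (cases "i \<le> (if 2 * p \<le> n then p else n - p)")
      case True
      then show ?thesis using m_eq unfolding s_def by presburger
    next
      case False
      then have "n - p < i" using that by (auto split: if_splits)
      then have "n + 1 - s \<le> n - p + i" "n + 1 - s \<le> 2 * i - 1" using s \<open>p \<le> n\<close> that by linarith+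
      then show ?thesis using m_eq False unfolding s_def by (simp only: if_False min_absorb1)
    qed
  qed
  have "n_seq n p m j = n_seq n p (\<lambda>i. min (n + 1 - kth_largest h (row_count V (p + 1 - i)) 1) (2 * i - 1)) j" for j
  proof (rule n_seq_cong)
    fix i assume "j < i" "i \<le> p"
    then show "m i = min (n + 1 - kth_largest h (row_count V (p + 1 - i)) 1) (2 * i - 1)"
      by (intro m) auto
  qed
  then show ?thesis
    unfolding selected_def Let_def conj1 m_def[symmetric] using tau by auto
qed

lemma U_selected_iff:
  assumes U: "U \<in> SST U.cells"
    and content: "\<forall>k\<in>{1..p}. (\<Sum>a\<le>h. row_count U a k) = part mu (p + 1 - k)"
  shows "(let p = conj_part mu 1;
          q = conj_part mu 2;
          \<sigma> = (\<lambda>i. row_of_leftmost U 1 (p + 1 - i));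
          \<tau> = (\<lambda>j. row_of_leftmost U 2 (p + 1 - j));
          m = (\<lambda>i. min (n + 1 - \<sigma> i) (2 * i - 1))
      in \<forall>j\<in>{1..q}. \<tau> j + n_seq n p m j \<le> n + 1) \<longleftrightarrow> selected n (\<lambda>k a. row_count U a k)"
proof -
  have conj1: "conj_part mu 1 = p" using conj_part_1[OF mu] by (simp add: p_def)
  have content': "(\<Sum>a\<le>h. row_count U a (p + 1 - i)) = part mu i" if "1 \<le> i" "i \<le> p" for i
  proof -
    have "p + 1 - i \<in> {1..p}" "p + 1 - (p + 1 - i) = i" using that by auto
    then show ?thesis using bspec[OF content, of "p + 1 - i"] by simp
  qed
  have sigma: "row_of_leftmost U 1 (p + 1 - i) = kth_largest h (\<lambda>a. row_count U a (p + 1 - i)) 1"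
    if "1 \<le> i" "i \<le> p" for i
    using that part_mu_pos[of i] content'[OF that]
    by (intro U.row_of_leftmost_eq[OF U]) auto
  have tau: "row_of_leftmost U 2 (p + 1 - j) = kth_largest h (\<lambda>a. row_count U a (p + 1 - j)) 2"
    if "1 \<le> j" "j \<le> conj_part mu 2" for j
    using that two_le_part[OF that] q_le_p content'[of j]
    by (intro U.row_of_leftmost_eq[OF U]) auto
  have "n_seq n p (\<lambda>i. min (n + 1 - row_of_leftmost U 1 (p + 1 - i)) (2 * i - 1)) j =
    n_seq n p (\<lambda>i. min (n + 1 - kth_largest h (\<lambda>a. row_count U a (p + 1 - i)) 1) (2 * i - 1)) j" for j
  proof (rule n_seq_cong)
    fix i assume "j < i" "i \<le> p"
    then show "min (n + 1 - row_of_leftmost U 1 (p + 1 - i)) (2 * i - 1) =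
        min (n + 1 - kth_largest h (\<lambda>a. row_count U a (p + 1 - i)) 1) (2 * i - 1)"
      using sigma[of i] by simp
  qed
  then show ?thesis
    unfolding selected_def Let_def conj1 using tau by auto
qed

lemma LR_tableaux_iff:
  "U \<in> LR_tableaux lam delta mu \<longleftrightarrow> U \<in> SST U.cells \<and> (\<forall>c. U c \<le> p) \<and>
    (\<forall>k\<in>{1..p}. (\<Sum>a\<le>h. row_count U a k) = part mu (p + 1 - k)) \<and>
    (\<forall>k. 1 \<le> k \<and> k < p \<longrightarrow>
      (\<forall>i. (\<Sum>a\<in>{i..h}. row_count U a k) \<le> (\<Sum>a\<in>{i<..h}. row_count U a (Suc k))))"
proof (cases "U \<in> SST U.cells")
  case True
  have cnt: "card {c. U c = k} = (\<Sum>a\<le>h. row_count U a k)" if "1 \<le> k" for k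
  proof -
    have "{c. U c = k} = {x \<in> shape U. U x = k \<and> fst x \<in> {..h}}"
    proof (rule set_eqI)
      fix c :: "nat \<times> nat"
      show "c \<in> {c. U c = k} \<longleftrightarrow> c \<in> {x \<in> shape U. U x = k \<and> fst x \<in> {..h}}"
      proof (cases "c \<in> U.cells")
        case c: True
        then have "fst c \<le> h" by (cases c) (simp add: U.mem_cells)
        then show ?thesis using c by (simp add: U.SST_shape[OF True])
      next
        case False
        then show ?thesis using U.SST_outside[OF True] that by (simp add: U.SST_shape[OF True])
      qed
    qed
    then show ?thesis using card_cells_in_rows[of U "{..h}" k] U.finite_cells
      by (simp add: U.SST_shape[OF True])
  qed
  define w where "w = reading_word U"
  have "(\<forall>a\<ge>1. \<forall>i. 1 < i \<and> i \<le> p \<longrightarrow>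
        count_list (drop (a - 1) w) (i - 1) \<le> count_list (drop (a - 1) w) i) \<longleftrightarrow>
      (\<forall>k. 1 \<le> k \<and> k < p \<longrightarrow> (\<forall>n. count_list (drop n w) k \<le> count_list (drop n w) (Suc k)))"
    (is "?A \<longleftrightarrow> ?B")
  proof
    assume A: ?A
    show ?B
    proof (intro allI impI)
      fix k n assume "1 \<le> k \<and> k < p"
      then show "count_list (drop n w) k \<le> count_list (drop n w) (Suc k)"
        using A[rule_format, of "Suc n" "Suc k"] by simp
    qed
  next
    assume B: ?B
    show ?A
    proof (intro allI impI)
      fix a i :: nat assume "1 < i \<and> i \<le> p"
      then show "count_list (drop (a - 1) w) (i - 1) \<le> count_list (drop (a - 1) w) i"
        using B[rule_format, of "i - 1" "a - 1"] by (cases i) auto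
    qed
  qed
  moreover have "diagram delta \<subseteq> diagram lam" using sub by (simp add: diagram_subset_iff)
  ultimately show ?thesis using True cnt
    by (auto simp: LR_tableaux_def cells_U p_def[symmetric] w_def U.anti_lattice_suffix_iff[OF True])
next
  case False
  then show ?thesis by (simp add: LR_tableaux_def cells_U)
qed

text \<open>A larger entry would contribute to a row of \<open>lam\<close> that is empty.\<close>

lemma V_entries_le:
  assumes V: "V \<in> SST V.cells" and target: "\<forall>a\<ge>1. part delta a + (\<Sum>k\<le>p. row_count V k a) = part lam a"
  shows "V c \<le> h"
proof (rule ccontr)
  assume "\<not> V c \<le> h"
  then have a: "h < V c" by simp
  then have "part lam (V c) = 0" by (rule part_lam_eq_0)
  then have "(\<Sum>k\<le>p. row_count V k (V c)) = 0" using target a by (metis One_nat_def Suc_leI add_is_0 gr_implies_not0 neq0_conv)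
  then have "card {x \<in> shape V. V x = V c \<and> fst x \<in> {..p}} = 0"
    using card_cells_in_rows[of V "{..p}" "V c"] V.finite_cells by (simp add: V.SST_shape[OF V])
  moreover have "c \<in> {x \<in> shape V. V x = V c \<and> fst x \<in> {..p}}"
  proof -
    have "c \<in> V.cells" using V.SST_outside[OF V, of c] a by (cases "c \<in> V.cells") auto
    then show ?thesis by (cases c) (simp add: V.SST_shape[OF V], simp add: V.mem_cells)
  qed
  moreover have "finite {x \<in> shape V. V x = V c \<and> fst x \<in> {..p}}"
    using V.finite_cells by (simp add: V.SST_shape[OF V])
  ultimately show False using card_0_eq by blast
qed

lemma c_under_eq_card_LR_if_subset:
  assumes "p \<le> n"
  shows "c_under n lam delta mu = card {U \<in> LR_tableaux lam delta mu.
     (let p = conj_part mu 1;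
          q = conj_part mu 2;
          \<sigma> = (\<lambda>i. row_of_leftmost U 1 (p + 1 - i));
          \<tau> = (\<lambda>j. row_of_leftmost U 2 (p + 1 - j));
          m = (\<lambda>i. min (n + 1 - \<sigma> i) (2 * i - 1))
      in \<forall>j\<in>{1..q}. \<tau> j + n_seq n p m j \<le> n + 1)}" (is "_ = card ?Us")
proof -
  define PV where "PV N \<longleftrightarrow>
      (\<forall>a\<ge>1. \<forall>i. part delta (Suc a) + (\<Sum>k\<le>i. N k (Suc a)) \<le> part delta a + (\<Sum>k<i. N k a)) \<and>
      (\<forall>a\<ge>1. part delta a + (\<Sum>k\<le>p. N k a) = part lam a)" for N :: "nat \<Rightarrow> nat \<Rightarrow> nat"
  define PU where "PU N \<longleftrightarrow> (\<forall>k\<in>{1..p}. (\<Sum>a\<le>h. N a k) = part mu (p + 1 - k)) \<and>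
      (\<forall>k. 1 \<le> k \<and> k < p \<longrightarrow> (\<forall>i. (\<Sum>a\<in>{i..h}. N a k) \<le> (\<Sum>a\<in>{i<..h}. N a (Suc k))))"
    for N :: "nat \<Rightarrow> nat \<Rightarrow> nat"
  define tr where "tr N = (\<lambda>a k. N k a)" for N :: "nat \<Rightarrow> nat \<Rightarrow> nat"
  have "c_under n lam delta mu =
      card {V \<in> {V \<in> SST V.cells. \<forall>c. V c \<le> h}. PV (row_count V) \<and> selected n (row_count V)}"
    unfolding c_under_def
  proof (rule arg_cong[of _ _ card], rule Collect_cong, unfold cells_V)
    fix V
    show "V \<in> SST V.cells \<and> insert_tableau V (columns (H_tableau delta)) = columns (H_tableau lam) \<and>
       (let p = conj_part mu 1;
          q = conj_part mu 2;
          r = (if 2 * p \<le> n then p else n - p);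
          \<sigma> = (\<lambda>i. V (p + 1 - i, part mu 1));
          \<tau> = (\<lambda>j. V (p + 1 - j, part mu 1 - 1));
          m = (\<lambda>i. if i \<le> r then min (n + 1 - \<sigma> i) (2 * i - 1)
                   else min (n + 1 - \<sigma> i) (n - p + i))
      in \<forall>j\<in>{1..q}. \<tau> j + n_seq n p m j \<le> n + 1) \<longleftrightarrow>
      V \<in> {V \<in> SST V.cells. \<forall>c. V c \<le> h} \<and> PV (row_count V) \<and> selected n (row_count V)"
    proof (cases "V \<in> SST V.cells \<and> PV (row_count V)")
      case True
      then have "\<forall>c. V c \<le> h" using V_entries_le unfolding PV_def by blast
      moreover have "insert_tableau V (columns (H_tableau delta)) = columns (H_tableau lam)"
        using True V.insert_tableau_H_iff[OF _ lam delta, of V] unfolding PV_def by blast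
      ultimately show ?thesis using V_selected_iff[of V n] True assms by auto
    next
      case False
      then show ?thesis using V.insert_tableau_H_iff[OF _ lam delta, of V] unfolding PV_def by blast
    qed
  qed
  also have "\<dots> = card {N \<in> V.contents h. PV N \<and> selected n N}"
    by (rule bij_betw_same_card, rule bij_betw_filter[OF V.bij_betw_row_count]) simp
  also have "\<dots> = card {N \<in> U.contents p. PU N \<and> selected n (tr N)}"
  proof (rule bij_betw_same_card[of tr], rule bij_betw_byWitness[of _ tr])
    have iff: "N \<in> V.contents h \<and> PV N \<longleftrightarrow> tr N \<in> U.contents p \<and> PU (tr N)" for N
      using contents_transpose_iff[of N] unfolding PV_def PU_def tr_def .
    have tr_tr: "tr (tr N) = N" for N by (simp add: tr_def)
    show "tr ` {N \<in> V.contents h. PV N \<and> selected n N} \<subseteq> {N \<in> U.contents p. PU N \<and> selected n (tr N)}"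
      using iff tr_tr by auto
    show "tr ` {N \<in> U.contents p. PU N \<and> selected n (tr N)} \<subseteq> {N \<in> V.contents h. PV N \<and> selected n N}"
      using iff[of "tr _"] tr_tr by auto
  qed (auto simp: tr_def)
  also have "\<dots> = card {U \<in> {U \<in> SST U.cells. \<forall>c. U c \<le> p}. PU (row_count U) \<and> selected n (tr (row_count U))}"
    by (rule bij_betw_same_card[symmetric], rule bij_betw_filter[OF U.bij_betw_row_count]) simp
  also have "{U \<in> {U \<in> SST U.cells. \<forall>c. U c \<le> p}. PU (row_count U) \<and> selected n (tr (row_count U))} = ?Us"
  proof (rule Collect_cong)
    fix U
    show "U \<in> {U \<in> SST U.cells. \<forall>c. U c \<le> p} \<and> PU (row_count U) \<and> selected n (tr (row_count U)) \<longleftrightarrow>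
      U \<in> LR_tableaux lam delta mu \<and> (let p = conj_part mu 1;
          q = conj_part mu 2;
          \<sigma> = (\<lambda>i. row_of_leftmost U 1 (p + 1 - i));
          \<tau> = (\<lambda>j. row_of_leftmost U 2 (p + 1 - j));
          m = (\<lambda>i. min (n + 1 - \<sigma> i) (2 * i - 1))
      in \<forall>j\<in>{1..q}. \<tau> j + n_seq n p m j \<le> n + 1)"
      unfolding LR_tableaux_iff PU_def tr_def using U_selected_iff[of U n] by blast
  qed
  finally show ?thesis .
qed

end

theorem corollary4p12:
  fixes n :: nat and lam delta mu :: "nat list"
  assumes "n \<ge> 1"
    and "is_partition mu" and "length mu \<le> n"
    and "conj_part mu 1 + conj_part mu 2 \<le> n"
    and "is_partition lam" and "length lam \<le> n"
    and "is_partition delta" and "length delta \<le> n" and "\<forall>x\<in>set delta. even x"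
  shows "c_under n lam delta mu = card {U \<in> LR_tableaux lam delta mu.
     (let p = conj_part mu 1;
          q = conj_part mu 2;
          \<sigma> = (\<lambda>i. row_of_leftmost U 1 (p + 1 - i));
          \<tau> = (\<lambda>j. row_of_leftmost U 2 (p + 1 - j));
          m = (\<lambda>i. min (n + 1 - \<sigma> i) (2 * i - 1))
      in \<forall>j\<in>{1..q}. \<tau> j + n_seq n p m j \<le> n + 1)}"
proof (cases "diagram delta \<subseteq> diagram lam")
  case True
  then have "\<And>a. part delta a \<le> part lam a" by (simp add: diagram_subset_iff)
  from c_under_eq_card_LR_if_subset[OF assms(2,5,7) this assms(3)] show ?thesis .
next
  case False
  interpret V: skew_shape "length mu" "left_end mu" "right_end mu"
    by (rule skew_shape_rotated[OF assms(2)])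
  \<comment> \<open>Insertion only enlarges the rows of \<open>delta\<close>, so both sides are zero.\<close>
  obtain a where a: "part lam a < part delta a" using False by (auto simp: diagram_subset_iff not_le)
  then have "1 \<le> a" by (cases a) (auto simp: Defs.part_def)
  have "rotated_diagram mu = V.cells"
    unfolding V.cells_def unfolding rotated_diagram_eq[OF assms(2)] left_end_def right_end_def ..
  then have "insert_tableau V (columns (H_tableau delta)) \<noteq> columns (H_tableau lam)"
    if "V \<in> SST (rotated_diagram mu)" for V
    using V.insert_tableau_H_iff[OF _ assms(5,7), of V] that a \<open>1 \<le> a\<close> by (metis le_add1 not_le)
  then have "c_under n lam delta mu = 0" unfolding c_under_def by (auto intro!: arg_cong[of _ "{}" card, simplified])
  moreover have "LR_tableaux lam delta mu = {}" using False by (auto simp: LR_tableaux_def)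
  ultimately show ?thesis by simp
qed

end
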